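(* Every $\omega$-canonical linear temporal logic is totally canonical. That is: let $M=\{\Diamond,\Diamond'\}$, with dual boxes $\Box,\blacksquare$, and let $L$ be a normal modal $M$-logic containing $p\to\blacksquare\Diamond p$, $p\to\Box\Diamond' p$, $\Diamond\Diamond p\to\Diamond p$, and, for each $\triangle\in\{\Diamond,\Diamond'\}$, the linearity axiom $$(\triangle q_0\wedge\triangle q_1)\to\bigl(\triangle(q_0\wedge(q_1\vee\triangle q_1))\vee\triangle(q_1\wedge(q_0\vee\triangle q_0))\bigr).$$ If $L$ is $\omega$-canonical, then $L$ is totally canonical.
   Context: Modal $M$-formulas are built from countably many atoms $q_0,q_1,\dots$ using $\top,\neg,\vee$ and the diamonds in $M$; $\Box\varphi=\neg\Diamond\neg\varphi$ and $\blacksquare\varphi=\neg\Diamond'\neg\varphi$. A normal modal $M$-logic is a set of $M$-formulas containing all propositional tautologies, the axioms $\Box(p\to q)\to(\Box p\to\Box q)$ and $\Diamond p\leftrightarrow\neg\Box\neg p$ (and the same for $\Diamond',\blacksquare$), closed under modus ponens, generalisation for both boxes, and uniform substitution. An $M$-BAO is a boolean algebra $\mathcal A$ with, for each diamond in $M$, an operation $\Diamond$ satisfying $\Diamond 0=0$ and $\Diamond(a+b)=\Diamond a+\Diamond b$. Formulas translate to algebra terms in the usual way (atoms become variables); $V_L$ denotes the variety of all $M$-BAOs in which the term translating each $\varphi\in L$ is identically $1$. The canonical frame $\mathcal A_+$ has the ultrafilters of $\mathcal A$ as points, with, for each diamond $\Diamond\in M$, $R_\Diamond\mu\nu$ iff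 $\Diamond a\in\mu$ for every $a\in\nu$. The canonical extension $\mathcal A^\sigma$ is the $M$-BAO of all subsets of $\mathcal A_+$ with $\Diamond X=\{\mu:\exists\nu\in X\ R_\Diamond\mu\nu\}$ for each $\Diamond\in M$. For a cardinal $\kappa$, $L$ is $\kappa$-canonical if $\mathcal A^\sigma\in V_L$ for every $\mathcal A\in V_L$ that is generated as an algebra by a subset of cardinality at most $\kappa$. $L$ is totally canonical if $\mathcal A^\sigma\in V_L$ for every $\mathcal A\in V_L$. *)

theory Defs
  imports "HOL-Library.Countable_Set"
begin

unbundle cardinal_syntax

subsection \<open>Modal formulas and normal logics\<close>

text \<open>The type variable \<open>'m\<close> is the set \<open>M\<close> of diamonds.\<close>

datatype 'm fm =
    Atom nat
  | Top
  | Neg "'m fm"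
  | Disj "'m fm" "'m fm"
  | Dia 'm "'m fm"

definition Conj :: "'m fm \<Rightarrow> 'm fm \<Rightarrow> 'm fm" where
  "Conj \<phi> \<psi> = Neg (Disj (Neg \<phi>) (Neg \<psi>))"

definition Imp :: "'m fm \<Rightarrow> 'm fm \<Rightarrow> 'm fm" where
  "Imp \<phi> \<psi> = Disj (Neg \<phi>) \<psi>"

definition Iff :: "'m fm \<Rightarrow> 'm fm \<Rightarrow> 'm fm" where
  "Iff \<phi> \<psi> = Conj (Imp \<phi> \<psi>) (Imp \<psi> \<phi>)"

definition Box :: "'m \<Rightarrow> 'm fm \<Rightarrow> 'm fm" where
  "Box m \<phi> = Neg (Dia m (Neg \<phi>))"

primrec subst :: "(nat \<Rightarrow> 'm fm) \<Rightarrow> 'm fm \<Rightarrow> 'm fm" where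
  "subst s (Atom n) = s n"
| "subst s Top = Top"
| "subst s (Neg \<phi>) = Neg (subst s \<phi>)"
| "subst s (Disj \<phi> \<psi>) = Disj (subst s \<phi>) (subst s \<psi>)"
| "subst s (Dia m \<phi>) = Dia m (subst s \<phi>)"

text \<open>For propositional purposes, atoms and formulas beginning with a diamond are both
  unanalysed: \<open>h\<close> gives them arbitrary truth values.\<close>

primrec prop_val :: "('m fm \<Rightarrow> bool) \<Rightarrow> 'm fm \<Rightarrow> bool" where
  "prop_val h (Atom n) = h (Atom n)"
| "prop_val h Top = True"
| "prop_val h (Neg \<phi>) = (\<not> prop_val h \<phi>)"
| "prop_val h (Disj \<phi> \<psi>) = (prop_val h \<phi> \<or> prop_val h \<psi>)"
| "prop_val h (Dia m \<phi>) = h (Dia m \<phi>)"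

definition tautology :: "'m fm \<Rightarrow> bool" where
  "tautology \<phi> \<longleftrightarrow> (\<forall>h. prop_val h \<phi>)"

definition normal_logic :: "'m fm set \<Rightarrow> bool" where
  "normal_logic L \<longleftrightarrow>
     (\<forall>\<phi>. tautology \<phi> \<longrightarrow> \<phi> \<in> L) \<and>
     (\<forall>m. Imp (Box m (Imp (Atom 0) (Atom 1))) (Imp (Box m (Atom 0)) (Box m (Atom 1))) \<in> L) \<and>
     (\<forall>m. Iff (Dia m (Atom 0)) (Neg (Box m (Neg (Atom 0)))) \<in> L) \<and>
     (\<forall>\<phi> \<psi>. \<phi> \<in> L \<longrightarrow> Imp \<phi> \<psi> \<in> L \<longrightarrow> \<psi> \<in> L) \<and>
     (\<forall>m \<phi>. \<phi> \<in> L \<longrightarrow> Box m \<phi> \<in> L) \<and>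
     (\<forall>s \<phi>. \<phi> \<in> L \<longrightarrow> subst s \<phi> \<in> L)"

subsection \<open>Boolean algebras with operators and their varieties\<close>

record ('m, 'a) bao =
  carr :: "'a set"
  plus_of :: "'a \<Rightarrow> 'a \<Rightarrow> 'a"
  times_of :: "'a \<Rightarrow> 'a \<Rightarrow> 'a"
  compl_of :: "'a \<Rightarrow> 'a"
  zero_of :: "'a"
  one_of :: "'a"
  dia_of :: "'m \<Rightarrow> 'a \<Rightarrow> 'a"

text \<open>Huntington's axioms for boolean algebras, relative to the carrier, followed by normality
  and additivity of the operators.  One-element algebras are allowed.\<close>

definition is_bao :: "('m, 'a) bao \<Rightarrow> bool" where
  "is_bao A \<longleftrightarrow>
     zero_of A \<in> carr A \<and> one_of A \<in> carr A \<and>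
     (\<forall>x\<in>carr A. compl_of A x \<in> carr A) \<and>
     (\<forall>x\<in>carr A. \<forall>y\<in>carr A. plus_of A x y \<in> carr A \<and> times_of A x y \<in> carr A) \<and>
     (\<forall>m. \<forall>x\<in>carr A. dia_of A m x \<in> carr A) \<and>
     (\<forall>x\<in>carr A. \<forall>y\<in>carr A. plus_of A x y = plus_of A y x \<and> times_of A x y = times_of A y x) \<and>
     (\<forall>x\<in>carr A. plus_of A x (zero_of A) = x \<and> times_of A x (one_of A) = x) \<and>
     (\<forall>x\<in>carr A. \<forall>y\<in>carr A. \<forall>z\<in>carr A.
        plus_of A x (times_of A y z) = times_of A (plus_of A x y) (plus_of A x z) \<and>
        times_of A x (plus_of A y z) = plus_of A (times_of A x y) (times_of A x z)) \<and>
     (\<forall>x\<in>carr A. plus_of A x (compl_of A x) = one_of A \<and> times_of A x (compl_of A x) = zero_of A) \<and>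
     (\<forall>m. dia_of A m (zero_of A) = zero_of A) \<and>
     (\<forall>m. \<forall>x\<in>carr A. \<forall>y\<in>carr A.
        dia_of A m (plus_of A x y) = plus_of A (dia_of A m x) (dia_of A m y))"

primrec eval :: "('m, 'a) bao \<Rightarrow> (nat \<Rightarrow> 'a) \<Rightarrow> 'm fm \<Rightarrow> 'a" where
  "eval A v (Atom n) = v n"
| "eval A v Top = one_of A"
| "eval A v (Neg \<phi>) = compl_of A (eval A v \<phi>)"
| "eval A v (Disj \<phi> \<psi>) = plus_of A (eval A v \<phi>) (eval A v \<psi>)"
| "eval A v (Dia m \<phi>) = dia_of A m (eval A v \<phi>)"

definition variety :: "'m fm set \<Rightarrow> ('m, 'a) bao set" where
  "variety L = {A. is_bao A \<and>
     (\<forall>\<phi>\<in>L. \<forall>v. range v \<subseteq> carr A \<longrightarrow> eval A v \<phi> = one_of A)}"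

inductive_set generate :: "('m, 'a) bao \<Rightarrow> 'a set \<Rightarrow> 'a set" for A X where
  base: "x \<in> X \<Longrightarrow> x \<in> generate A X"
| zero: "zero_of A \<in> generate A X"
| one: "one_of A \<in> generate A X"
| compl: "x \<in> generate A X \<Longrightarrow> compl_of A x \<in> generate A X"
| plus: "x \<in> generate A X \<Longrightarrow> y \<in> generate A X \<Longrightarrow> plus_of A x y \<in> generate A X"
| times: "x \<in> generate A X \<Longrightarrow> y \<in> generate A X \<Longrightarrow> times_of A x y \<in> generate A X"
| dia: "x \<in> generate A X \<Longrightarrow> dia_of A m x \<in> generate A X"

subsection \<open>Canonical frames and canonical extensions\<close>

definition ultrafilters :: "('m, 'a) bao \<Rightarrow> 'a set set" where
  "ultrafilters A = {\<mu>. \<mu> \<subseteq> carr A \<and> one_of A \<in> \<mu> \<and> zero_of A \<notin> \<mu> \<and>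
     (\<forall>x\<in>\<mu>. \<forall>y\<in>\<mu>. times_of A x y \<in> \<mu>) \<and>
     (\<forall>x\<in>\<mu>. \<forall>y\<in>carr A. times_of A x y = x \<longrightarrow> y \<in> \<mu>) \<and>
     (\<forall>x\<in>carr A. x \<in> \<mu> \<or> compl_of A x \<in> \<mu>)}"

definition canon_rel :: "('m, 'a) bao \<Rightarrow> 'm \<Rightarrow> 'a set \<Rightarrow> 'a set \<Rightarrow> bool" where
  "canon_rel A m \<mu> \<nu> \<longleftrightarrow> (\<forall>x\<in>\<nu>. dia_of A m x \<in> \<mu>)"

definition canon_ext :: "('m, 'a) bao \<Rightarrow> ('m, 'a set set) bao" where
  "canon_ext A = \<lparr>
     carr = Pow (ultrafilters A),
     plus_of = (\<union>),
     times_of = (\<inter>),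
     compl_of = (\<lambda>X. ultrafilters A - X),
     zero_of = {},
     one_of = ultrafilters A,
     dia_of = (\<lambda>m X. {\<mu>\<in>ultrafilters A. \<exists>\<nu>\<in>X. canon_rel A m \<mu> \<nu>})\<rparr>"

subsection \<open>Canonicity\<close>

text \<open>
  HOL cannot quantify over all types inside a formula, so both notions carry a type \<open>'a\<close> and
  range over all algebras whose carrier is a subset of \<open>'a\<close>.  As usual in HOL, a cardinal
  \<open>\<kappa>\<close> is given by a cardinal order; \<open>\<omega>\<close> is \<^const>\<open>natLeq\<close>.  For \<open>\<kappa> = \<omega>\<close> and countable \<open>M\<close>,
  an algebra with at most \<open>\<kappa>\<close> generators is countable, so nothing is lost by taking
  \<open>'a = nat\<close>; this is lemma \<open>omega_canonical_transfer\<close> below.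
\<close>

definition kappa_canonical :: "'a itself \<Rightarrow> 'k rel \<Rightarrow> 'm fm set \<Rightarrow> bool" where
  "kappa_canonical TYPE('a) \<kappa> L \<longleftrightarrow>
     (\<forall>A :: ('m, 'a) bao. A \<in> variety L \<longrightarrow>
        (\<exists>X \<subseteq> carr A. |X| \<le>o \<kappa> \<and> generate A X = carr A) \<longrightarrow> canon_ext A \<in> variety L)"

definition totally_canonical :: "'a itself \<Rightarrow> 'm fm set \<Rightarrow> bool" where
  "totally_canonical TYPE('a) L \<longleftrightarrow>
     (\<forall>A :: ('m, 'a) bao. A \<in> variety L \<longrightarrow> canon_ext A \<in> variety L)"

subsection \<open>Linear temporal logics\<close>

text \<open>\<open>Dia Fut\<close> is \<open>\<Diamond>\<close> and \<open>Dia Past\<close> is \<open>\<Diamond>'\<close>, so \<open>Box Fut\<close> is \<open>\<box>\<close> and \<open>Box Past\<close> is the black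
  box.\<close>

datatype tense = Fut | Past

definition linearity_axiom :: "'m \<Rightarrow> 'm fm" where
  "linearity_axiom m =
     Imp (Conj (Dia m (Atom 0)) (Dia m (Atom 1)))
         (Disj (Dia m (Conj (Atom 0) (Disj (Atom 1) (Dia m (Atom 1)))))
               (Dia m (Conj (Atom 1) (Disj (Atom 0) (Dia m (Atom 0))))))"

definition linear_temporal_logic :: "tense fm set \<Rightarrow> bool" where
  "linear_temporal_logic L \<longleftrightarrow> normal_logic L \<and>
     Imp (Atom 0) (Box Past (Dia Fut (Atom 0))) \<in> L \<and>
     Imp (Atom 0) (Box Fut (Dia Past (Atom 0))) \<in> L \<and>
     Imp (Dia Fut (Dia Fut (Atom 0))) (Dia Fut (Atom 0)) \<in> L \<and>
     (\<forall>m. linearity_axiom m \<in> L)"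

instance tense :: countable
proof
  have "inj (\<lambda>t. case t of Fut \<Rightarrow> 0 | Past \<Rightarrow> Suc 0)"
    by (auto simp: inj_def split: tense.splits)
  then show "\<exists>f :: tense \<Rightarrow> nat. inj f" by blast
qed

subsection \<open>Independence of \<open>\<omega>\<close>-canonicity of the carrier type\<close>

definition bao_iso :: "('a \<Rightarrow> 'b) \<Rightarrow> ('m, 'a) bao \<Rightarrow> ('m, 'b) bao \<Rightarrow> bool" where
  "bao_iso f A B \<longleftrightarrow> bij_betw f (carr A) (carr B) \<and>
     f (zero_of A) = zero_of B \<and> f (one_of A) = one_of B \<and>
     (\<forall>x\<in>carr A. f (compl_of A x) = compl_of B (f x)) \<and>
     (\<forall>x\<in>carr A. \<forall>y\<in>carr A. f (plus_of A x y) = plus_of B (f x) (f y) \<and>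
        f (times_of A x y) = times_of B (f x) (f y)) \<and>
     (\<forall>m. \<forall>x\<in>carr A. f (dia_of A m x) = dia_of B m (f x))"

lemma bao_closed:
  assumes "is_bao A"
  shows "zero_of A \<in> carr A" "one_of A \<in> carr A"
    "\<And>x. x \<in> carr A \<Longrightarrow> compl_of A x \<in> carr A"
    "\<And>x y. x \<in> carr A \<Longrightarrow> y \<in> carr A \<Longrightarrow> plus_of A x y \<in> carr A"
    "\<And>x y. x \<in> carr A \<Longrightarrow> y \<in> carr A \<Longrightarrow> times_of A x y \<in> carr A"
    "\<And>m x. x \<in> carr A \<Longrightarrow> dia_of A m x \<in> carr A"
  using assms unfolding is_bao_def by blast+

lemma eval_in_carr:
  assumes "is_bao A" "range v \<subseteq> carr A"
  shows "eval A v \<phi> \<in> carr A"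
  using assms(2) by (induction \<phi>) (auto simp: bao_closed[OF assms(1)])

lemma is_bao_canon_ext: "is_bao (canon_ext A)"
  by (auto simp: is_bao_def canon_ext_def)

lemma bao_iso_is_bao:
  assumes i: "bao_iso f A B" and A: "is_bao A"
  shows "is_bao B"
proof -
  have s: "carr B = f ` carr A"
    and h: "f (zero_of A) = zero_of B" "f (one_of A) = one_of B"
    using i by (auto simp: bao_iso_def bij_betw_def)
  have c: "\<And>x. x \<in> carr A \<Longrightarrow> compl_of B (f x) = f (compl_of A x)"
    "\<And>x y. x \<in> carr A \<Longrightarrow> y \<in> carr A \<Longrightarrow> plus_of B (f x) (f y) = f (plus_of A x y)"
    "\<And>x y. x \<in> carr A \<Longrightarrow> y \<in> carr A \<Longrightarrow> times_of B (f x) (f y) = f (times_of A x y)"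
    "\<And>m x. x \<in> carr A \<Longrightarrow> dia_of B m (f x) = f (dia_of A m x)"
    using i by (auto simp: bao_iso_def)
  show ?thesis
    unfolding is_bao_def s h[symmetric] ball_simps
  proof (intro conjI)
    show "f (zero_of A) \<in> f ` carr A" "f (one_of A) \<in> f ` carr A"
      by (simp_all add: bao_closed[OF A])
    show "\<forall>x\<in>carr A. compl_of B (f x) \<in> f ` carr A"
      "\<forall>m. \<forall>x\<in>carr A. dia_of B m (f x) \<in> f ` carr A"
      "\<forall>x\<in>carr A. \<forall>y\<in>carr A. plus_of B (f x) (f y) \<in> f ` carr A \<and> times_of B (f x) (f y) \<in> f ` carr A"
      by (simp_all add: c bao_closed[OF A])
    show "\<forall>x\<in>carr A. \<forall>y\<in>carr A. plus_of B (f x) (f y) = plus_of B (f y) (f x) \<and>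
        times_of B (f x) (f y) = times_of B (f y) (f x)"
    proof (intro ballI)
      fix x y assume m: "x \<in> carr A" "y \<in> carr A"
      have "plus_of A x y = plus_of A y x" "times_of A x y = times_of A y x"
        using A m unfolding is_bao_def by blast+
      then show "plus_of B (f x) (f y) = plus_of B (f y) (f x) \<and>
          times_of B (f x) (f y) = times_of B (f y) (f x)"
        by (simp only: c m simp_thms)
    qed
    show "\<forall>x\<in>carr A. plus_of B (f x) (f (zero_of A)) = f x \<and> times_of B (f x) (f (one_of A)) = f x"
    proof (intro ballI)
      fix x assume m: "x \<in> carr A"
      have "plus_of A x (zero_of A) = x" "times_of A x (one_of A) = x"
        using A m unfolding is_bao_def by blast+
      then show "plus_of B (f x) (f (zero_of A)) = f x \<and> times_of B (f x) (f (one_of A)) = f x"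
        by (simp add: c m bao_closed[OF A])
    qed
    show "\<forall>x\<in>carr A. \<forall>y\<in>carr A. \<forall>z\<in>carr A.
        plus_of B (f x) (times_of B (f y) (f z)) =
          times_of B (plus_of B (f x) (f y)) (plus_of B (f x) (f z)) \<and>
        times_of B (f x) (plus_of B (f y) (f z)) =
          plus_of B (times_of B (f x) (f y)) (times_of B (f x) (f z))"
    proof (intro ballI conjI)
      fix x y z assume m: "x \<in> carr A" "y \<in> carr A" "z \<in> carr A"
      have "plus_of A x (times_of A y z) = times_of A (plus_of A x y) (plus_of A x z)"
        "times_of A x (plus_of A y z) = plus_of A (times_of A x y) (times_of A x z)"
        using A m unfolding is_bao_def by blast+
      then show "plus_of B (f x) (times_of B (f y) (f z)) =
          times_of B (plus_of B (f x) (f y)) (plus_of B (f x) (f z))"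
        "times_of B (f x) (plus_of B (f y) (f z)) =
          plus_of B (times_of B (f x) (f y)) (times_of B (f x) (f z))"
        using m bao_closed(4,5)[OF A] by (simp_all only: c)
    qed
    show "\<forall>x\<in>carr A. plus_of B (f x) (compl_of B (f x)) = f (one_of A) \<and>
        times_of B (f x) (compl_of B (f x)) = f (zero_of A)"
    proof (intro ballI)
      fix x assume m: "x \<in> carr A"
      have "plus_of A x (compl_of A x) = one_of A" "times_of A x (compl_of A x) = zero_of A"
        using A m unfolding is_bao_def by blast+
      then show "plus_of B (f x) (compl_of B (f x)) = f (one_of A) \<and>
        times_of B (f x) (compl_of B (f x)) = f (zero_of A)"
        by (simp add: c m bao_closed[OF A])
    qed
    show "\<forall>m. dia_of B m (f (zero_of A)) = f (zero_of A)"
    proof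
      fix m have "dia_of A m (zero_of A) = zero_of A" using A unfolding is_bao_def by blast
      then show "dia_of B m (f (zero_of A)) = f (zero_of A)" by (simp add: c bao_closed[OF A])
    qed
    show "\<forall>m. \<forall>x\<in>carr A. \<forall>y\<in>carr A.
        dia_of B m (plus_of B (f x) (f y)) = plus_of B (dia_of B m (f x)) (dia_of B m (f y))"
    proof (intro allI ballI)
      fix m x y assume m: "x \<in> carr A" "y \<in> carr A"
      have "dia_of A m (plus_of A x y) = plus_of A (dia_of A m x) (dia_of A m y)"
        using A m unfolding is_bao_def by blast
      then show "dia_of B m (plus_of B (f x) (f y)) = plus_of B (dia_of B m (f x)) (dia_of B m (f y))"
        by (simp add: c m bao_closed[OF A])
    qed
  qed
qed

lemma bao_iso_eval:
  assumes i: "bao_iso f A B" and A: "is_bao A" and v: "range v \<subseteq> carr A"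
  shows "f (eval A v \<phi>) = eval B (f \<circ> v) \<phi>"
  using i eval_in_carr[OF A v] by (induction \<phi>) (simp_all add: bao_iso_def)

lemma bao_iso_variety:
  assumes i: "bao_iso f A B" and A: "A \<in> variety L"
  shows "B \<in> variety L"
proof -
  have bA: "is_bao A" using A by (simp add: variety_def)
  have "eval B w \<phi> = one_of B" if "\<phi> \<in> L" "range w \<subseteq> carr B" for w \<phi>
  proof -
    define v where "v = inv_into (carr A) f \<circ> w"
    have b: "bij_betw f (carr A) (carr B)" using i by (simp add: bao_iso_def)
    have v: "range v \<subseteq> carr A"
      using that(2) b by (auto simp: v_def bij_betw_def intro!: inv_into_into)
    have w: "f \<circ> v = w"
    proof
      fix n have "w n \<in> f ` carr A" using that(2) b by (auto simp: bij_betw_def)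
      then show "(f \<circ> v) n = w n" by (simp add: v_def f_inv_into_f)
    qed
    have "eval A v \<phi> = one_of A" using A that(1) v by (auto simp: variety_def)
    then show ?thesis using bao_iso_eval[OF i bA v, of \<phi>] i by (simp add: w bao_iso_def)
  qed
  then show ?thesis using bao_iso_is_bao[OF i bA] by (simp add: variety_def)
qed

lemma bao_iso_inv:
  assumes i: "bao_iso f A B" and A: "is_bao A"
  shows "bao_iso (inv_into (carr A) f) B A"
proof -
  have b: "bij_betw f (carr A) (carr B)" using i by (simp add: bao_iso_def)
  have s: "carr B = f ` carr A" and inj: "inj_on f (carr A)"
    using b by (auto simp: bij_betw_def)
  have h: "zero_of B = f (zero_of A)" "one_of B = f (one_of A)"
    "\<And>x. x \<in> carr A \<Longrightarrow> compl_of B (f x) = f (compl_of A x)"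
    "\<And>x y. x \<in> carr A \<Longrightarrow> y \<in> carr A \<Longrightarrow> plus_of B (f x) (f y) = f (plus_of A x y)"
    "\<And>x y. x \<in> carr A \<Longrightarrow> y \<in> carr A \<Longrightarrow> times_of B (f x) (f y) = f (times_of A x y)"
    "\<And>m x. x \<in> carr A \<Longrightarrow> dia_of B m (f x) = f (dia_of A m x)"
    using i by (auto simp: bao_iso_def)
  have "bij_betw (inv_into (carr A) f) (carr B) (carr A)" by (rule bij_betw_inv_into[OF b])
  moreover have "inv_into (carr A) f (f x) = x" if "x \<in> carr A" for x
    using inv_into_f_f[OF inj that] .
  ultimately show ?thesis
    unfolding bao_iso_def s by (simp add: h bao_closed[OF A])
qed

lemma ultrafilters_image:
  assumes i: "bao_iso f A B" and A: "is_bao A" and U: "\<mu> \<in> ultrafilters A"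
  shows "f ` \<mu> \<in> ultrafilters B"
proof -
  have s: "carr B = f ` carr A" and inj: "inj_on f (carr A)"
    using i by (auto simp: bao_iso_def bij_betw_def)
  have h: "zero_of B = f (zero_of A)" "one_of B = f (one_of A)"
    "\<And>x. x \<in> carr A \<Longrightarrow> compl_of B (f x) = f (compl_of A x)"
    "\<And>x y. x \<in> carr A \<Longrightarrow> y \<in> carr A \<Longrightarrow> times_of B (f x) (f y) = f (times_of A x y)"
    using i by (auto simp: bao_iso_def)
  have sub: "\<mu> \<subseteq> carr A" using U by (simp add: ultrafilters_def)
  have mem: "f x \<in> f ` \<mu> \<longleftrightarrow> x \<in> \<mu>" if "x \<in> carr A" for x
    by (rule inj_on_image_mem_iff[OF inj that sub])
  note t = bao_closed(5)[OF A] and z = bao_closed(1,2)[OF A]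
  show ?thesis
    unfolding ultrafilters_def mem_Collect_eq
  proof (intro conjI)
    show "f ` \<mu> \<subseteq> carr B" using sub s by auto
    show "one_of B \<in> f ` \<mu>" "zero_of B \<notin> f ` \<mu>"
      unfolding h mem[OF z(1)] mem[OF z(2)] using U by (auto simp only: ultrafilters_def mem_Collect_eq)
    show "\<forall>x\<in>f ` \<mu>. \<forall>y\<in>f ` \<mu>. times_of B x y \<in> f ` \<mu>"
    proof clarify
      fix x y assume m: "x \<in> \<mu>" "y \<in> \<mu>"
      then have "times_of A x y \<in> \<mu>" using U unfolding ultrafilters_def by blast
      moreover have "times_of B (f x) (f y) = f (times_of A x y)" using h(4) m sub by blast
      ultimately show "times_of B (f x) (f y) \<in> f ` \<mu>" by simp
    qed
    show "\<forall>x\<in>f ` \<mu>. \<forall>y\<in>carr B. times_of B x y = x \<longrightarrow> y \<in> f ` \<mu>"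
      unfolding s
    proof clarify
      fix x y assume m: "x \<in> \<mu>" "y \<in> carr A" and e: "times_of B (f x) (f y) = f x"
      have xA: "x \<in> carr A" using m sub by blast
      have "f (times_of A x y) = f x" using e h(4)[OF xA m(2)] by simp
      then have "times_of A x y = x" using inj_onD[OF inj _ t[OF xA m(2)] xA] by blast
      then have "y \<in> \<mu>" using U m unfolding ultrafilters_def by blast
      then show "f y \<in> f ` \<mu>" by blast
    qed
    show "\<forall>x\<in>carr B. x \<in> f ` \<mu> \<or> compl_of B x \<in> f ` \<mu>"
      unfolding s
    proof clarify
      fix x assume m: "x \<in> carr A" and "compl_of B (f x) \<notin> f ` \<mu>"
      then have "compl_of A x \<notin> \<mu>" using h(3)[OF m] by auto
      then have "x \<in> \<mu>" using U m unfolding ultrafilters_def by blast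
      then show "f x \<in> f ` \<mu>" by blast
    qed
  qed
qed

lemma bao_iso_canon_ext:
  assumes i: "bao_iso f A B" and A: "is_bao A"
  shows "bao_iso (image (image f)) (canon_ext A) (canon_ext B)"
proof -
  let ?U = "ultrafilters A" and ?V = "ultrafilters B" and ?g = "inv_into (carr A) f"
  have b: "bij_betw f (carr A) (carr B)" using i by (simp add: bao_iso_def)
  have inj: "inj_on f (carr A)" using b by (simp add: bij_betw_def)
  have B: "is_bao B" by (rule bao_iso_is_bao[OF i A])
  have sub: "\<mu> \<subseteq> carr A" if "\<mu> \<in> ?U" for \<mu> using that by (simp add: ultrafilters_def)
  have injU: "inj_on (image f) ?U"
    by (rule inj_on_subset[OF inj_on_image_Pow[OF inj]]) (auto dest: sub)
  have UV: "image f ` ?U = ?V"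
  proof
    show "image f ` ?U \<subseteq> ?V" using ultrafilters_image[OF i A] by auto
    show "?V \<subseteq> image f ` ?U"
    proof
      fix \<nu> assume n: "\<nu> \<in> ?V"
      have "?g ` \<nu> \<in> ?U" by (rule ultrafilters_image[OF bao_iso_inv[OF i A] B n])
      moreover have "f ` ?g ` \<nu> = \<nu>"
        by (rule image_inv_into_cancel[where A = "carr A"])
          (use n b in \<open>auto simp: ultrafilters_def bij_betw_def\<close>)
      ultimately show "\<nu> \<in> image f ` ?U" by (metis image_eqI)
    qed
  qed
  have rel: "canon_rel B m (f ` \<mu>) (f ` \<nu>) \<longleftrightarrow> canon_rel A m \<mu> \<nu>"
    if "\<mu> \<in> ?U" "\<nu> \<in> ?U" for m \<mu> \<nu>
  proof -
    have "dia_of B m (f x) \<in> f ` \<mu> \<longleftrightarrow> dia_of A m x \<in> \<mu>" if x: "x \<in> \<nu>" for x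
    proof -
      have xA: "x \<in> carr A" using x sub[OF \<open>\<nu> \<in> ?U\<close>] by auto
      then have d: "dia_of A m x \<in> carr A" by (rule bao_closed(6)[OF A])
      have "dia_of B m (f x) = f (dia_of A m x)" using i xA by (simp add: bao_iso_def)
      then show ?thesis using inj_on_image_mem_iff[OF inj d sub[OF \<open>\<mu> \<in> ?U\<close>]] by simp
    qed
    then show ?thesis by (simp add: canon_rel_def)
  qed
  have "bij_betw (image (image f)) (Pow ?U) (Pow ?V)"
    using bij_betw_Pow[of "image f" ?U ?V] injU UV by (simp add: bij_betw_def)
  moreover have "image f ` (?U - X) = ?V - image f ` X" if "X \<subseteq> ?U" for X
    using inj_on_image_set_diff[OF injU, of ?U X] that UV by auto
  moreover have "image f ` (X \<inter> Y) = image f ` X \<inter> image f ` Y" if "X \<subseteq> ?U" "Y \<subseteq> ?U" for X Y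
    using inj_on_image_Int[OF injU that] .
  moreover have "image f ` {\<mu> \<in> ?U. \<exists>\<nu>\<in>X. canon_rel A m \<mu> \<nu>}
      = {\<mu> \<in> ?V. \<exists>\<nu>\<in>image f ` X. canon_rel B m \<mu> \<nu>}" if X: "X \<subseteq> ?U" for m X
  proof -
    have "(\<exists>\<nu>\<in>image f ` X. canon_rel B m (f ` \<mu>) \<nu>) \<longleftrightarrow> (\<exists>\<nu>\<in>X. canon_rel A m \<mu> \<nu>)"
      if "\<mu> \<in> ?U" for \<mu>
      using rel[OF that] X by blast
    then show ?thesis unfolding UV[symmetric] by blast
  qed
  ultimately show ?thesis
    using UV by (simp add: bao_iso_def canon_ext_def image_Un)
qed

lemma countable_generate:
  fixes A :: "('m::countable, 'a) bao"
  assumes X: "countable X"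
  shows "countable (generate A X)"
proof -
  define F where "F Y = Y \<union> compl_of A ` Y \<union> (\<lambda>(x, y). plus_of A x y) ` (Y \<times> Y)
    \<union> (\<lambda>(x, y). times_of A x y) ` (Y \<times> Y) \<union> (\<Union>m. dia_of A m ` Y)" for Y
  define S where "S n = (F ^^ n) (X \<union> {zero_of A, one_of A})" for n
  have S0: "S 0 = X \<union> {zero_of A, one_of A}" and SS: "S (Suc n) = F (S n)" for n
    by (simp_all add: S_def)
  have "countable (S n)" for n
  proof (induction n)
    case 0 show ?case using X by (simp add: S0)
  next
    case (Suc n) then show ?case unfolding SS F_def
      by (intro countable_Un countable_image countable_SIGMA countable_UN) auto
  qed
  then have cnt: "countable (\<Union>n. S n)" by blast
  have mono: "S i \<subseteq> S j" if "i \<le> j" for i j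
    using that by (rule lift_Suc_mono_le[rotated]) (auto simp: SS F_def)
  have "x \<in> (\<Union>n. S n)" if "x \<in> generate A X" for x
    using that
  proof induction
    case (base x) then show ?case using S0 by blast
  next
    case zero then show ?case using S0 by blast
  next
    case one then show ?case using S0 by blast
  next
    case (compl x)
    then obtain n where "x \<in> S n" by blast
    then have "compl_of A x \<in> S (Suc n)" by (auto simp: SS F_def)
    then show ?case by blast
  next
    case (plus x y)
    then obtain i j where "x \<in> S i" "y \<in> S j" by blast
    then have "x \<in> S (max i j)" "y \<in> S (max i j)"
      using mono[of i "max i j"] mono[of j "max i j"] by auto
    then have "plus_of A x y \<in> S (Suc (max i j))" by (auto simp: SS F_def)
    then show ?case by blast
  next
    case (times x y)
    then obtain i j where "x \<in> S i" "y \<in> S j" by blast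
    then have "x \<in> S (max i j)" "y \<in> S (max i j)"
      using mono[of i "max i j"] mono[of j "max i j"] by auto
    then have "times_of A x y \<in> S (Suc (max i j))" by (auto simp: SS F_def)
    then show ?case by blast
  next
    case (dia x m)
    then obtain n where "x \<in> S n" by blast
    then have "dia_of A m x \<in> S (Suc n)" by (auto simp: SS F_def)
    then show ?case by blast
  qed
  then show ?thesis using cnt by (meson countable_subset subsetI)
qed

lemma bao_iso_generate:
  assumes i: "bao_iso f A B" and X: "X \<subseteq> carr A" and g: "generate A X = carr A"
  shows "generate B (f ` X) = carr B"
proof
  have s: "carr B = f ` generate A X" using i g by (auto simp: bao_iso_def bij_betw_def)
  have h: "f (zero_of A) = zero_of B" "f (one_of A) = one_of B"
    "\<And>x. x \<in> generate A X \<Longrightarrow> f (compl_of A x) = compl_of B (f x)"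
    "\<And>x y. x \<in> generate A X \<Longrightarrow> y \<in> generate A X \<Longrightarrow> f (plus_of A x y) = plus_of B (f x) (f y)"
    "\<And>x y. x \<in> generate A X \<Longrightarrow> y \<in> generate A X \<Longrightarrow> f (times_of A x y) = times_of B (f x) (f y)"
    "\<And>m x. x \<in> generate A X \<Longrightarrow> f (dia_of A m x) = dia_of B m (f x)"
    using i unfolding bao_iso_def g by blast+
  have "f x \<in> generate B (f ` X)" if "x \<in> generate A X" for x
    using that by induction (simp_all only: h, auto intro: generate.intros)
  then show "carr B \<subseteq> generate B (f ` X)" using s by auto
  have "y \<in> f ` generate A X" if "y \<in> generate B (f ` X)" for y
    using that
  proof induction
    case (base y) then show ?case by (auto intro: generate.base)
  next
    case zero show ?case unfolding h(1)[symmetric] by (intro imageI generate.zero)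
  next
    case one show ?case unfolding h(2)[symmetric] by (intro imageI generate.one)
  next
    case (compl y)
    then obtain x where x: "x \<in> generate A X" "y = f x" by blast
    show ?case unfolding x(2) h(3)[OF x(1), symmetric] by (intro imageI generate.compl x)
  next
    case (plus y z)
    then obtain x w where x: "x \<in> generate A X" "y = f x" and w: "w \<in> generate A X" "z = f w"
      by blast
    show ?case unfolding x(2) w(2) h(4)[OF x(1) w(1), symmetric]
      by (intro imageI generate.plus x w)
  next
    case (times y z)
    then obtain x w where x: "x \<in> generate A X" "y = f x" and w: "w \<in> generate A X" "z = f w"
      by blast
    show ?case unfolding x(2) w(2) h(5)[OF x(1) w(1), symmetric]
      by (intro imageI generate.times x w)
  next
    case (dia y m)
    then obtain x where x: "x \<in> generate A X" "y = f x" by blast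
    show ?case unfolding x(2) h(6)[OF x(1), symmetric] by (intro imageI generate.dia x)
  qed
  then show "generate B (f ` X) \<subseteq> carr B" using s by blast
qed

lemma omega_canonical_transfer:
  fixes L :: "'m::countable fm set"
  assumes can: "kappa_canonical TYPE(nat) natLeq L"
  shows "kappa_canonical TYPE('a) natLeq L"
  unfolding kappa_canonical_def
proof (intro allI impI)
  fix A :: "('m, 'a) bao"
  assume A: "A \<in> variety L"
    and "\<exists>X\<subseteq>carr A. |X| \<le>o natLeq \<and> generate A X = carr A"
  then obtain X where X: "X \<subseteq> carr A" "|X| \<le>o natLeq" "generate A X = carr A" by blast
  have bA: "is_bao A" using A by (simp add: variety_def)
  have nat: "|UNIV :: nat set| =o natLeq" by (rule card_of_nat)
  have "|X| \<le>o |UNIV :: nat set|"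
    using X(2) nat by (metis ordLeq_ordIso_trans ordIso_symmetric)
  then have "countable X" by (auto simp: card_of_ordLeq[symmetric] countable_def)
  then have "countable (carr A)" using countable_generate[of X A] X(3) by simp
  then obtain f :: "'a \<Rightarrow> nat" where f: "inj_on f (carr A)" by (auto simp: countable_def)
  define g where "g = inv_into (carr A) f"
  define N :: "('m, nat) bao" where "N = \<lparr>
     carr = f ` carr A,
     plus_of = (\<lambda>x y. f (plus_of A (g x) (g y))),
     times_of = (\<lambda>x y. f (times_of A (g x) (g y))),
     compl_of = (\<lambda>x. f (compl_of A (g x))),
     zero_of = f (zero_of A),
     one_of = f (one_of A),
     dia_of = (\<lambda>m x. f (dia_of A m (g x)))\<rparr>"
  have i: "bao_iso f A N"
    using f by (simp add: bao_iso_def N_def g_def bij_betw_def)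
  have N: "N \<in> variety L" by (rule bao_iso_variety[OF i A])
  have bN: "is_bao N" using N by (simp add: variety_def)
  have "f ` X \<subseteq> carr N" using X(1) by (auto simp: N_def)
  moreover have "|f ` X| \<le>o natLeq" using card_of_image X(2) ordLeq_transitive by blast
  moreover have "generate N (f ` X) = carr N" by (rule bao_iso_generate[OF i X(1) X(3)])
  ultimately have "canon_ext N \<in> variety L"
    using can N unfolding kappa_canonical_def by blast
  then show "canon_ext A \<in> variety L"
    by (rule bao_iso_variety[OF bao_iso_canon_ext[OF bao_iso_inv[OF i bA] bN]])
qed

end

theory Submission
  imports Defs
begin

text \<open>
  Let \<open>\<mu>\<close> be a point of the canonical frame of an arbitrary algebra \<open>A\<close> in the variety, and let a
  valuation \<open>V\<close> and a theorem \<open>\<phi>\<close> be given.  The aim is a countable subalgebra \<open>B\<close> and a valuation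
  on its canonical frame that gives \<open>\<phi>\<close> the same value at \<open>\<mu> \<inter> B\<close> as \<open>V\<close> does at \<open>\<mu>\<close>; as \<open>\<phi>\<close> is valid
  in the canonical frame of \<open>B\<close>, it is then true at \<open>\<mu>\<close>.

  The connected component of \<open>\<mu>\<close> is a linear order of clusters, and compactness makes it Dedekind
  complete (\<open>sup_exists\<close>).  Colour each point by the subformulas of \<open>\<phi>\<close> that are true at it.  A
  Loewenheim--Skolem argument (\<open>hull_exists\<close>) gives a countable set \<open>W\<close> of points and a countable
  subalgebra \<open>B\<close> such that \<open>W\<close> embeds in the canonical frame of \<open>B\<close> and is closed under
  witnesses and under suprema of definable sets.  The canonical frame of \<open>B\<close> has more points than \<open>W\<close>.
  Some share a cluster with a point of \<open>W\<close> and can copy its colour.  Any other one, a gap point,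
  determines a cut of \<open>W\<close> in which the lower part has no last and the upper part no first cluster
  (\<open>gap_no_last\<close>).  Such a cut is not definable from the colours, because definable cuts have a
  supremum in \<open>W\<close>; so the colours that occur cofinally below it and those that occur coinitially
  above it cannot be disjoint (\<open>gap_colour\<close>).  A gap point is given such a common colour.  What this
  colour says about the future is correct because the colour occurs just above the gap, and what it
  says about the past because it occurs just below (\<open>collapse_dia\<close>).
\<close>

section \<open>Boolean algebra relative to a carrier\<close>

locale bao =
  fixes A :: "('m, 'a) bao"
  assumes is_bao: "is_bao A"
begin

abbreviation join (infixl "\<oplus>" 65) where "x \<oplus> y \<equiv> plus_of A x y"
abbreviation meet (infixl "\<otimes>" 70) where "x \<otimes> y \<equiv> times_of A x y"
abbreviation cpl ("\<ominus> _" [80] 80) where "\<ominus> x \<equiv> compl_of A x"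
abbreviation bot_el ("\<zero>") where "\<zero> \<equiv> zero_of A"
abbreviation top_el ("\<one>") where "\<one> \<equiv> one_of A"
abbreviation U where "U \<equiv> ultrafilters A"
abbreviation R where "R \<equiv> canon_rel A"

lemmas closed [simp] = bao_closed[OF is_bao]

lemma huntington:
  assumes "x \<in> carr A" "y \<in> carr A"
  shows "x \<oplus> y = y \<oplus> x" "x \<otimes> y = y \<otimes> x" "x \<oplus> \<zero> = x" "x \<otimes> \<one> = x"
    "x \<oplus> \<ominus> x = \<one>" "x \<otimes> \<ominus> x = \<zero>" "dia_of A m \<zero> = \<zero>"
    "dia_of A m (x \<oplus> y) = dia_of A m x \<oplus> dia_of A m y"
  using is_bao assms unfolding is_bao_def by blast+

lemma distribs:
  assumes "x \<in> carr A" "y \<in> carr A" "z \<in> carr A"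
  shows "x \<oplus> (y \<otimes> z) = (x \<oplus> y) \<otimes> (x \<oplus> z)" "x \<otimes> (y \<oplus> z) = (x \<otimes> y) \<oplus> (x \<otimes> z)"
  using is_bao assms unfolding is_bao_def by blast+

lemma meet_idem: assumes x: "x \<in> carr A" shows "x \<otimes> x = x"
proof -
  have "x = x \<otimes> (x \<oplus> \<ominus> x)" using huntington(4,5)[OF x x] by simp
  also have "\<dots> = x \<otimes> x \<oplus> x \<otimes> \<ominus> x" using x by (intro distribs) auto
  also have "\<dots> = x \<otimes> x" using x by (simp only: huntington(6)[OF x x] huntington(3) closed)
  finally show ?thesis by simp
qed

lemma meet_bot: assumes x: "x \<in> carr A" shows "x \<otimes> \<zero> = \<zero>"
proof -
  have "\<zero> = x \<otimes> (\<ominus> x \<oplus> \<zero>)"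
    using x by (simp only: huntington(3)[OF closed(3) x] huntington(6)[OF x x])
  also have "\<dots> = x \<otimes> \<ominus> x \<oplus> x \<otimes> \<zero>" using x by (intro distribs) auto
  also have "\<dots> = x \<otimes> \<zero> \<oplus> \<zero>"
    using huntington(1)[of \<zero> "x \<otimes> \<zero>"] x by (simp add: huntington(6)[OF x x])
  also have "\<dots> = x \<otimes> \<zero>" using x by (simp only: huntington(3) closed)
  finally show ?thesis by simp
qed

lemma join_top: assumes x: "x \<in> carr A" shows "x \<oplus> \<one> = \<one>"
proof -
  have "\<one> = x \<oplus> (\<ominus> x \<otimes> \<one>)"
    using x by (simp only: huntington(4)[OF closed(3) x] huntington(5)[OF x x])
  also have "\<dots> = (x \<oplus> \<ominus> x) \<otimes> (x \<oplus> \<one>)" using x by (intro distribs) auto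
  also have "\<dots> = (x \<oplus> \<one>) \<otimes> \<one>"
    using huntington(2)[of \<one> "x \<oplus> \<one>"] x by (simp add: huntington(5)[OF x x])
  also have "\<dots> = x \<oplus> \<one>" using x by (simp only: huntington(4) closed)
  finally show ?thesis by simp
qed

lemma absorb_join: assumes x: "x \<in> carr A" and y: "y \<in> carr A" shows "x \<oplus> (x \<otimes> y) = x"
proof -
  have "x \<oplus> (x \<otimes> y) = (x \<otimes> \<one>) \<oplus> (x \<otimes> y)" using huntington(4)[OF x x] by simp
  also have "\<dots> = x \<otimes> (\<one> \<oplus> y)" using x y by (intro distribs[symmetric]) auto
  also have "\<dots> = x"
    using huntington(1)[OF closed(2) y] join_top[OF y] huntington(4)[OF x x] by simp
  finally show ?thesis .
qed

lemma absorb_meet: assumes x: "x \<in> carr A" and y: "y \<in> carr A" shows "x \<otimes> (x \<oplus> y) = x"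
proof -
  have "x \<otimes> (x \<oplus> y) = (x \<oplus> \<zero>) \<otimes> (x \<oplus> y)" using huntington(3)[OF x x] by simp
  also have "\<dots> = x \<oplus> (\<zero> \<otimes> y)" using x y by (intro distribs[symmetric]) auto
  also have "\<dots> = x"
    using huntington(2)[OF closed(1) y] meet_bot[OF y] huntington(3)[OF x x] by simp
  finally show ?thesis .
qed

text \<open>Associativity: both sides have the same join with \<open>x\<close> and the same join with its
  complement, and an element is the meet of these two joins.\<close>

lemma meet_assoc:
  assumes x: "x \<in> carr A" and y: "y \<in> carr A" and z: "z \<in> carr A"
  shows "(x \<otimes> y) \<otimes> z = x \<otimes> (y \<otimes> z)"
proof -
  let ?l = "(x \<otimes> y) \<otimes> z" and ?r = "x \<otimes> (y \<otimes> z)"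
  have c: "?l \<in> carr A" "?r \<in> carr A" using assms by auto
  have split: "u = (u \<oplus> x) \<otimes> (u \<oplus> \<ominus> x)" if "u \<in> carr A" for u
    using distribs(1)[OF that x closed(3)[OF x]] huntington(3)[OF that] huntington(6)[OF x] that
    by (metis x)
  have "x \<oplus> ?l = (x \<oplus> x \<otimes> y) \<otimes> (x \<oplus> z)" using assms by (intro distribs) auto
  also have "\<dots> = x" using assms by (simp add: absorb_join absorb_meet)
  finally have 1: "x \<oplus> ?l = x \<oplus> ?r" using assms by (simp add: absorb_join)
  have e: "\<ominus> x \<oplus> x \<otimes> w = \<ominus> x \<oplus> w" if "w \<in> carr A" for w
  proof -
    have "\<ominus> x \<oplus> x \<otimes> w = (\<ominus> x \<oplus> x) \<otimes> (\<ominus> x \<oplus> w)" using x that by (intro distribs) auto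
    also have "\<dots> = \<ominus> x \<oplus> w"
      using x that huntington(1)[OF x closed(3)[OF x]] huntington(5)[OF x x]
        huntington(2,4)[of "\<ominus> x \<oplus> w" \<one>] by (metis closed(2,3,4))
    finally show ?thesis .
  qed
  have "\<ominus> x \<oplus> ?l = (\<ominus> x \<oplus> x \<otimes> y) \<otimes> (\<ominus> x \<oplus> z)" using assms by (intro distribs) auto
  also have "\<dots> = (\<ominus> x \<oplus> y) \<otimes> (\<ominus> x \<oplus> z)" using y by (simp only: e)
  also have "\<dots> = \<ominus> x \<oplus> (y \<otimes> z)" using assms by (intro distribs[symmetric]) auto
  also have "\<dots> = \<ominus> x \<oplus> ?r" using assms by (simp add: e)
  finally have 2: "\<ominus> x \<oplus> ?l = \<ominus> x \<oplus> ?r" .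
  show ?thesis
    using 1 2 split[OF c(1)] split[OF c(2)] c x by (metis closed(3) huntington(1))
qed

section \<open>Ultrafilters\<close>

text \<open>Among the sets above \<open>F\<close> that are closed under meets and avoid \<open>\<zero>\<close>, a maximal one
  contains every element that has nonzero meet with all its members; this makes it an
  ultrafilter.\<close>

lemma ultrafilter_extension:
  assumes F: "F \<subseteq> carr A" "F \<noteq> {}" and mult: "\<And>x y. x \<in> F \<Longrightarrow> y \<in> F \<Longrightarrow> x \<otimes> y \<in> F" and nz: "\<zero> \<notin> F"
  obtains \<mu> where "\<mu> \<in> U" "F \<subseteq> \<mu>"
proof -
  define \<F> where "\<F> = {G. F \<subseteq> G \<and> G \<subseteq> carr A \<and> \<zero> \<notin> G \<and> (\<forall>x\<in>G. \<forall>y\<in>G. x \<otimes> y \<in> G)}"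
  have "\<exists>G\<in>\<F>. \<forall>X\<in>\<F>. G \<subseteq> X \<longrightarrow> X = G"
  proof (rule subset_Zorn_nonempty)
    show "\<F> \<noteq> {}" using assms by (auto simp: \<F>_def)
    fix \<C> assume C: "\<C> \<noteq> {}" "subset.chain \<F> \<C>"
    have sub: "\<C> \<subseteq> \<F>" and tot: "\<And>X Y. X \<in> \<C> \<Longrightarrow> Y \<in> \<C> \<Longrightarrow> X \<subseteq> Y \<or> Y \<subseteq> X"
      using C(2) by (auto simp: subset.chain_def)
    have "x \<otimes> y \<in> \<Union>\<C>" if "x \<in> \<Union>\<C>" "y \<in> \<Union>\<C>" for x y
    proof -
      from that obtain X Y where "X \<in> \<C>" "Y \<in> \<C>" "x \<in> X" "y \<in> Y" by blast
      with tot obtain Z where "Z \<in> \<C>" "x \<in> Z" "y \<in> Z" by blast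
      then show ?thesis using sub by (auto simp: \<F>_def)
    qed
    then show "\<Union>\<C> \<in> \<F>" using sub C(1) unfolding \<F>_def by blast
  qed
  then obtain G where G: "G \<in> \<F>" and max: "\<And>X. X \<in> \<F> \<Longrightarrow> G \<subseteq> X \<Longrightarrow> X = G" by blast
  have Gc: "G \<subseteq> carr A" and Gz: "\<zero> \<notin> G" and Gm: "\<And>x y. x \<in> G \<Longrightarrow> y \<in> G \<Longrightarrow> x \<otimes> y \<in> G"
    and FG: "F \<subseteq> G"
    using G by (auto simp: \<F>_def)
  obtain a where a: "a \<in> F" "a \<in> carr A" using F by blast
  have "\<one> \<noteq> \<zero>" using huntington(4)[OF a(2) a(2)] meet_bot[OF a(2)] a(1) nz by auto
  have topl: "\<one> \<otimes> x = x" "x \<otimes> \<one> = x" if "x \<in> carr A" for x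
    using that huntington(2,4) by (metis closed(2))+
  have "insert \<one> G \<in> \<F>"
    using Gc Gz Gm FG \<open>\<one> \<noteq> \<zero>\<close> topl by (auto simp: \<F>_def subset_iff)
  then have top: "\<one> \<in> G" using max[of "insert \<one> G"] by blast
  have memI: "y \<in> G" if y: "y \<in> carr A" and ny: "\<And>h. h \<in> G \<Longrightarrow> h \<otimes> y \<noteq> \<zero>" for y
  proof -
    let ?H = "G \<union> (\<lambda>h. h \<otimes> y) ` G"
    have 1: "g \<otimes> (h \<otimes> y) = (g \<otimes> h) \<otimes> y" if "g \<in> G" "h \<in> G" for g h
      using that Gc y by (simp add: meet_assoc subset_iff)
    have 2: "(g \<otimes> y) \<otimes> h = (g \<otimes> h) \<otimes> y" if "g \<in> G" "h \<in> G" for g h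
      
    proof -
      have c: "g \<in> carr A" "h \<in> carr A" using that Gc by auto
      have "(g \<otimes> y) \<otimes> h = g \<otimes> (y \<otimes> h)" using c y by (rule_tac meet_assoc)
      also have "\<dots> = g \<otimes> (h \<otimes> y)" using huntington(2)[OF y c(2)] by simp
      finally show ?thesis using c y by (simp add: meet_assoc)
    qed
    have 3: "(g \<otimes> y) \<otimes> (h \<otimes> y) = (g \<otimes> h) \<otimes> y" if "g \<in> G" "h \<in> G" for g h
    proof -
      have c: "g \<in> carr A" "h \<in> carr A" using that Gc by auto
      have "(g \<otimes> y) \<otimes> (h \<otimes> y) = ((g \<otimes> y) \<otimes> h) \<otimes> y" using c y by (simp add: meet_assoc)
      also have "\<dots> = ((g \<otimes> h) \<otimes> y) \<otimes> y" using 2[OF that] by simp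
      also have "\<dots> = (g \<otimes> h) \<otimes> y" using c y by (simp add: meet_assoc meet_idem)
      finally show ?thesis .
    qed
    have "?H \<subseteq> carr A" using Gc y by auto
    moreover have "\<zero> \<notin> ?H" using Gz ny[THEN not_sym] by blast
    moreover have "u \<otimes> v \<in> ?H" if uv: "u \<in> ?H" "v \<in> ?H" for u v
    proof -
      consider "u \<in> G" "v \<in> G" | h where "u \<in> G" "h \<in> G" "v = h \<otimes> y"
        | g where "g \<in> G" "u = g \<otimes> y" "v \<in> G"
        | g h where "g \<in> G" "u = g \<otimes> y" "h \<in> G" "v = h \<otimes> y"
        using uv by blast
      then show ?thesis by cases (auto simp: 1 2 3 intro: Gm)
    qed
    ultimately have "?H \<in> \<F>" using FG unfolding \<F>_def by blast
    then have "?H = G" using max[of ?H] by blast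
    moreover have "\<one> \<otimes> y \<in> ?H" using top by blast
    ultimately show ?thesis using topl(1)[OF y] by simp
  qed
  have "G \<in> U"
    unfolding ultrafilters_def
  proof (intro CollectI conjI ballI impI)
    fix x y assume xy: "x \<in> G" "y \<in> carr A" "x \<otimes> y = x"
    show "y \<in> G"
    proof (rule memI[OF xy(2)])
      fix h assume h: "h \<in> G"
      have c: "h \<in> carr A" "x \<in> carr A" using h xy Gc by auto
      show "h \<otimes> y \<noteq> \<zero>"
      proof
        assume 0: "h \<otimes> y = \<zero>"
        have "h \<otimes> x = h \<otimes> (y \<otimes> x)" using xy c huntington(2)[of x y] by metis
        also have "\<dots> = \<zero> \<otimes> x" using c xy(2) by (simp add: meet_assoc[symmetric] 0)
        also have "\<dots> = \<zero>" using c meet_bot huntington(2) by (metis closed(1))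
        finally show False using Gm[OF h xy(1)] Gz by simp
      qed
    qed
  next
    fix x assume x: "x \<in> carr A"
    show "x \<in> G \<or> \<ominus> x \<in> G"
    proof (rule ccontr)
      assume "\<not> ?thesis"
      then obtain h k where hk: "h \<in> G" "h \<otimes> x = \<zero>" "k \<in> G" "k \<otimes> \<ominus> x = \<zero>"
        using memI[OF x] memI[OF closed(3)[OF x]] by blast
      have c: "h \<in> carr A" "k \<in> carr A" using hk Gc by auto
      have "h \<otimes> k = (h \<otimes> k) \<otimes> (x \<oplus> \<ominus> x)" using c x by (simp add: huntington(5)[OF x x] topl)
      also have "\<dots> = (h \<otimes> k) \<otimes> x \<oplus> (h \<otimes> k) \<otimes> \<ominus> x" using c x by (intro distribs) auto
      also have "(h \<otimes> k) \<otimes> x = k \<otimes> (h \<otimes> x)"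
        using c x by (metis huntington(2) meet_assoc)
      also have "(h \<otimes> k) \<otimes> \<ominus> x = h \<otimes> (k \<otimes> \<ominus> x)" using c x by (simp add: meet_assoc)
      finally have "h \<otimes> k = \<zero>" using c hk by (simp add: meet_bot huntington(3)[of \<zero> \<zero>])
      then show False using Gm[OF hk(1,3)] Gz by simp
    qed
  qed (use Gc Gz Gm top in auto)
  then show thesis using that FG by blast
qed

lemma ultrafilter_mem_aux:
  assumes \<mu>: "\<mu> \<in> U" and x: "x \<in> carr A" and y: "y \<in> carr A"
  shows "\<ominus> x \<in> \<mu> \<longleftrightarrow> x \<notin> \<mu>" "x \<otimes> y \<in> \<mu> \<longleftrightarrow> x \<in> \<mu> \<and> y \<in> \<mu>"
    "x \<oplus> y \<in> \<mu> \<longleftrightarrow> x \<in> \<mu> \<or> y \<in> \<mu>"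
proof -
  have up: "v \<in> \<mu>" if "u \<in> \<mu>" "v \<in> carr A" "u \<otimes> v = u" for u v
    using \<mu> that unfolding ultrafilters_def by blast
  have m: "u \<otimes> v \<in> \<mu>" if "u \<in> \<mu>" "v \<in> \<mu>" for u v
    using \<mu> that unfolding ultrafilters_def by blast
  have z: "\<zero> \<notin> \<mu>" using \<mu> unfolding ultrafilters_def by blast
  have cp: "u \<in> \<mu> \<or> \<ominus> u \<in> \<mu>" if "u \<in> carr A" for u
    using \<mu> that unfolding ultrafilters_def by blast
  show 1: "\<ominus> x \<in> \<mu> \<longleftrightarrow> x \<notin> \<mu>" using m[of x "\<ominus> x"] z cp[OF x] huntington(6)[OF x x] by auto
  have mr: "v \<in> \<mu>" if "u \<otimes> v \<in> \<mu>" "u \<in> carr A" "v \<in> carr A" for u v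
    using up[OF that(1,3)] that(2,3) by (simp add: meet_assoc meet_idem)
  show "x \<otimes> y \<in> \<mu> \<longleftrightarrow> x \<in> \<mu> \<and> y \<in> \<mu>"
    using mr[of x y] mr[of y x] m x y huntington(2)[OF x y] by auto
  have "y \<in> \<mu>" if "x \<oplus> y \<in> \<mu>" "x \<notin> \<mu>"
  proof (rule mr)
    have "\<ominus> x \<otimes> (x \<oplus> y) \<in> \<mu>" using that 1 m by blast
    moreover have "\<ominus> x \<otimes> (x \<oplus> y) = \<ominus> x \<otimes> y"
      using x y distribs(2)[of "\<ominus> x" x y] huntington(6)[OF x x] huntington(2)[of x "\<ominus> x"]
        huntington(1)[of \<zero> "\<ominus> x \<otimes> y"] huntington(3)[of "\<ominus> x \<otimes> y" x] by simp
    ultimately show "\<ominus> x \<otimes> y \<in> \<mu>" by simp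
  qed (use x y in auto)
  moreover have "x \<oplus> y \<in> \<mu>" if "x \<in> \<mu>"
    using up[OF that] x y by (simp add: absorb_meet)
  moreover have "x \<oplus> y \<in> \<mu>" if "y \<in> \<mu>"
    using up[OF that, of "x \<oplus> y"] x y absorb_meet[OF y x] huntington(1)[OF x y] by simp
  ultimately show "x \<oplus> y \<in> \<mu> \<longleftrightarrow> x \<in> \<mu> \<or> y \<in> \<mu>" by blast
qed

lemma ultrafilter_mem:
  assumes "\<mu> \<in> U" "x \<in> carr A"
  shows ultrafilter_cpl: "\<ominus> x \<in> \<mu> \<longleftrightarrow> x \<notin> \<mu>"
    and ultrafilter_meet: "y \<in> carr A \<Longrightarrow> x \<otimes> y \<in> \<mu> \<longleftrightarrow> x \<in> \<mu> \<and> y \<in> \<mu>"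
    and ultrafilter_join: "y \<in> carr A \<Longrightarrow> x \<oplus> y \<in> \<mu> \<longleftrightarrow> x \<in> \<mu> \<or> y \<in> \<mu>"
  using ultrafilter_mem_aux[OF assms] assms by (auto simp only:)

lemma ultrafilterD:
  assumes "\<mu> \<in> U"
  shows "\<mu> \<subseteq> carr A" "\<one> \<in> \<mu>" "\<zero> \<notin> \<mu>"
  using assms unfolding ultrafilters_def mem_Collect_eq by - (elim conjE, assumption)+

text \<open>From here on boolean laws are checked pointwise on ultrafilters.\<close>

lemma ultrafilter_zero:
  assumes x: "x \<in> carr A" and "\<And>\<mu>. \<mu> \<in> U \<Longrightarrow> x \<notin> \<mu>"
  shows "x = \<zero>"
proof (rule ccontr)
  assume "x \<noteq> \<zero>"
  then obtain \<mu> where "\<mu> \<in> U" "{x} \<subseteq> \<mu>"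
    using ultrafilter_extension[of "{x}"] x by (auto simp: meet_idem)
  then show False using assms(2) by blast
qed

lemma ultrafilter_eqI:
  assumes x: "x \<in> carr A" and y: "y \<in> carr A" and eq: "\<And>\<mu>. \<mu> \<in> U \<Longrightarrow> x \<in> \<mu> \<longleftrightarrow> y \<in> \<mu>"
  shows "x = y"
proof -
  have "u \<otimes> v = u" if u: "u \<in> carr A" and v: "v \<in> carr A" and "\<And>\<mu>. \<mu> \<in> U \<Longrightarrow> u \<in> \<mu> \<longleftrightarrow> v \<in> \<mu>" for u v
  proof -
    have 0: "u \<otimes> \<ominus> v = \<zero>"
      by (rule ultrafilter_zero) (use that in \<open>auto simp: ultrafilter_mem\<close>)
    have "u = u \<otimes> (v \<oplus> \<ominus> v)" using u v by (simp add: huntington(4)[OF u u] huntington(5)[OF v v])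
    also have "\<dots> = u \<otimes> v \<oplus> u \<otimes> \<ominus> v" using u v by (intro distribs) auto
    finally show ?thesis using u v by (simp add: 0 huntington(3)[of "u \<otimes> v" u])
  qed
  from this[OF x y eq] this[OF y x] eq show ?thesis using huntington(2)[OF x y] by metis
qed

lemma dia_mono:
  assumes x: "x \<in> carr A" and y: "y \<in> carr A" and le: "\<And>\<nu>. \<nu> \<in> U \<Longrightarrow> x \<in> \<nu> \<Longrightarrow> y \<in> \<nu>"
    and \<mu>: "\<mu> \<in> U" and "dia_of A m x \<in> \<mu>"
  shows "dia_of A m y \<in> \<mu>"
proof -
  have "x \<oplus> y = y" by (rule ultrafilter_eqI) (use x y le in \<open>auto simp: ultrafilter_join\<close>)
  then have "dia_of A m x \<oplus> dia_of A m y = dia_of A m y" using huntington(8)[OF x y] by metis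
  then show ?thesis using ultrafilter_join[OF \<mu>, of "dia_of A m x" "dia_of A m y"] assms x y by auto
qed

text \<open>A successor of \<open>\<mu>\<close> above \<open>F\<close> must avoid every \<open>c\<close> with \<open>dia_of A m c \<notin> \<mu>\<close>.  The elements
  \<open>a \<otimes> \<ominus> c\<close> collect these requirements, and additivity of the operator makes them closed under
  meets.\<close>

lemma successor_extension:
  assumes \<mu>: "\<mu> \<in> U" and F: "F \<subseteq> carr A" "F \<noteq> {}"
    and mult: "\<And>x y. x \<in> F \<Longrightarrow> y \<in> F \<Longrightarrow> x \<otimes> y \<in> F"
    and dia: "\<And>x. x \<in> F \<Longrightarrow> dia_of A m x \<in> \<mu>"
  obtains \<nu> where "\<nu> \<in> U" "F \<subseteq> \<nu>" "R m \<mu> \<nu>"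
proof -
  define N where "N = {c \<in> carr A. dia_of A m c \<notin> \<mu>}"
  define G where "G = {a \<otimes> \<ominus> c | a c. a \<in> F \<and> c \<in> N}"
  have N0: "\<zero> \<in> N"
    using ultrafilterD[OF \<mu>] huntington(7)[of \<zero> \<zero> m] by (simp add: N_def)
  have Nj: "c \<oplus> d \<in> N" if "c \<in> N" "d \<in> N" for c d
    using that ultrafilter_join[OF \<mu>, of "dia_of A m c" "dia_of A m d"]
    by (auto simp: N_def huntington(8))
  have Gc: "G \<subseteq> carr A" using F by (auto simp: G_def N_def)
  have "\<exists>\<nu>. \<nu> \<in> U \<and> G \<subseteq> \<nu>"
  proof (rule ultrafilter_extension[of G])
    show "G \<subseteq> carr A" by (fact Gc)
    show "G \<noteq> {}" using F(2) N0 by (auto simp: G_def)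
    show "x \<otimes> y \<in> G" if xy: "x \<in> G" "y \<in> G" for x y
    proof -
      obtain a c b d where e: "x = a \<otimes> \<ominus> c" "y = b \<otimes> \<ominus> d" "a \<in> F" "b \<in> F" "c \<in> N" "d \<in> N"
        using xy by (auto simp: G_def)
      have cc: "a \<in> carr A" "b \<in> carr A" "c \<in> carr A" "d \<in> carr A"
        using e F by (auto simp: N_def)
      have "x \<otimes> y = (a \<otimes> b) \<otimes> \<ominus> (c \<oplus> d)"
        unfolding e(1,2) by (rule ultrafilter_eqI) (use cc in \<open>auto simp: ultrafilter_mem\<close>)
      moreover have "a \<otimes> b \<in> F" "c \<oplus> d \<in> N" using mult e Nj by auto
      ultimately show ?thesis unfolding G_def by blast
    qed
    show "\<zero> \<notin> G"
    proof
      assume "\<zero> \<in> G"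
      then obtain a c where e: "\<zero> = a \<otimes> \<ominus> c" "a \<in> F" "c \<in> N" by (auto simp: G_def)
      then have cc: "a \<in> carr A" "c \<in> carr A" using F by (auto simp: N_def)
      have "c \<in> \<nu>" if "\<nu> \<in> U" "a \<in> \<nu>" for \<nu>
        using ultrafilterD(3)[OF that(1)] ultrafilter_meet[OF that(1) cc(1) closed(3)[OF cc(2)]]
          ultrafilter_cpl[OF that(1) cc(2)] that(2) e(1) by simp
      then have "dia_of A m c \<in> \<mu>" using dia_mono[OF cc _ \<mu>] dia[OF e(2)] by blast
      then show False using e(3) by (simp add: N_def)
    qed
  qed blast
  then obtain \<nu> where \<nu>: "\<nu> \<in> U" "G \<subseteq> \<nu>" by blast
  have G: "a \<in> \<nu>" "c \<notin> \<nu>" if "a \<in> F" "c \<in> N" for a c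
  proof -
    have "a \<otimes> \<ominus> c \<in> \<nu>" using that \<nu> by (auto simp: G_def)
    then show "a \<in> \<nu>" "c \<notin> \<nu>"
      using that F ultrafilter_mem[OF \<nu>(1)] by (auto simp: N_def)
  qed
  have "R m \<mu> \<nu>"
    unfolding canon_rel_def
  proof
    fix x assume "x \<in> \<nu>"
    then show "dia_of A m x \<in> \<mu>"
      using G(2)[of _ x] F(2) ultrafilterD(1)[OF \<nu>(1)] by (auto simp: N_def)
  qed
  then show thesis using that \<nu>(1) G(1) N0 by blast
qed

lemma dia_iff:
  assumes \<mu>: "\<mu> \<in> U" and x: "x \<in> carr A"
  shows "dia_of A m x \<in> \<mu> \<longleftrightarrow> (\<exists>\<nu>\<in>U. R m \<mu> \<nu> \<and> x \<in> \<nu>)"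
proof
  assume "dia_of A m x \<in> \<mu>"
  then obtain \<nu> where "\<nu> \<in> U" "{x} \<subseteq> \<nu>" "R m \<mu> \<nu>"
    using successor_extension[OF \<mu>, of "{x}" m] x by (auto simp: meet_idem)
  then show "\<exists>\<nu>\<in>U. R m \<mu> \<nu> \<and> x \<in> \<nu>" by blast
qed (auto simp: canon_rel_def)

end

section \<open>Frames of linear tense algebras\<close>

primrec opp :: "tense \<Rightarrow> tense" where
  "opp Fut = Past"
| "opp Past = Fut"

lemma opp_opp [simp]: "opp (opp m) = m"
  by (cases m) auto

locale tense_algebra =
  fixes L :: "tense fm set" and A :: "(tense, 'a) bao"
  assumes logic: "linear_temporal_logic L" and variety: "A \<in> variety L"
begin

sublocale bao A
  using variety by unfold_locales (simp add: variety_def)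

lemma theorem_mem:
  assumes "\<phi> \<in> L" "a \<in> carr A" "b \<in> carr A" "\<mu> \<in> U"
  shows "eval A (\<lambda>n. if n = 0 then a else b) \<phi> \<in> \<mu>"
proof -
  have "range (\<lambda>n::nat. if n = 0 then a else b) \<subseteq> carr A" using assms by auto
  then have "eval A (\<lambda>n. if n = 0 then a else b) \<phi> = \<one>"
    using variety assms(1) unfolding variety_def by blast
  then show ?thesis using ultrafilterD(2)[OF assms(4)] by simp
qed

lemma mem_carr: "\<mu> \<in> U \<Longrightarrow> x \<in> \<mu> \<Longrightarrow> x \<in> carr A"
  using ultrafilterD(1) by blast

lemma dia_mem: "R m \<mu> \<nu> \<Longrightarrow> x \<in> \<nu> \<Longrightarrow> dia_of A m x \<in> \<mu>"
  by (simp add: canon_rel_def)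

text \<open>The first two axioms of the logic make the two canonical relations converse to each other, so
  what is proved for an arbitrary \<open>m\<close> can be used in both directions of time.\<close>

lemma rel_converse_imp:
  assumes \<mu>: "\<mu> \<in> U" and \<nu>: "\<nu> \<in> U" and r: "R m \<mu> \<nu>"
  shows "R (opp m) \<nu> \<mu>"
  unfolding canon_rel_def
proof
  fix a assume a: "a \<in> \<mu>"
  have ca: "a \<in> carr A" using a \<mu> by (rule_tac mem_carr)
  have "Imp (Atom 0) (Box m (Dia (opp m) (Atom 0))) \<in> L"
    using logic by (cases m) (auto simp: linear_temporal_logic_def)
  from theorem_mem[OF this ca ca \<mu>] have "dia_of A m (\<ominus> dia_of A (opp m) a) \<notin> \<mu>"
    using a ca \<mu> by (simp add: Imp_def Box_def ultrafilter_mem)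
  then have "\<ominus> dia_of A (opp m) a \<notin> \<nu>" using dia_mem[OF r] by blast
  then show "dia_of A (opp m) a \<in> \<nu>" using ca \<nu> by (simp add: ultrafilter_mem)
qed

lemma rel_opp: "\<mu> \<in> U \<Longrightarrow> \<nu> \<in> U \<Longrightarrow> R (opp m) \<nu> \<mu> \<longleftrightarrow> R m \<mu> \<nu>"
  using rel_converse_imp[of \<mu> \<nu> m] rel_converse_imp[of \<nu> \<mu> "opp m"] by auto

lemma rel_trans_Fut:
  assumes U: "\<mu> \<in> U" "\<nu> \<in> U" "\<rho> \<in> U" and r: "R Fut \<mu> \<nu>" "R Fut \<nu> \<rho>"
  shows "R Fut \<mu> \<rho>"
  unfolding canon_rel_def
proof
  fix a assume a: "a \<in> \<rho>"
  then have ca: "a \<in> carr A" using U mem_carr by blast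
  have "Imp (Dia Fut (Dia Fut (Atom 0))) (Dia Fut (Atom 0)) \<in> L"
    using logic by (simp add: linear_temporal_logic_def)
  from theorem_mem[OF this ca ca U(1)] show "dia_of A Fut a \<in> \<mu>"
    using dia_mem[OF r(1) dia_mem[OF r(2) a]] ca U by (simp add: Imp_def ultrafilter_mem)
qed

lemma rel_trans:
  assumes U: "\<mu> \<in> U" "\<nu> \<in> U" "\<rho> \<in> U" and r: "R m \<mu> \<nu>" "R m \<nu> \<rho>"
  shows "R m \<mu> \<rho>"
proof (cases m)
  case Fut
  then show ?thesis using rel_trans_Fut[OF U] r by simp
next
  case Past
  then show ?thesis using rel_trans_Fut[OF U(3,2,1)] r rel_opp[of _ _ Fut] U by simp
qed

text \<open>If \<open>\<nu>\<close> and \<open>\<rho>\<close> were distinct and unrelated, elements \<open>e\<close>, \<open>b\<close>, \<open>c\<close> witnessing this would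
  give \<open>p \<in> \<nu>\<close> and \<open>q \<in> \<rho>\<close> such that no point has \<open>p\<close> together with, or before, \<open>q\<close>, and vice
  versa.  Since \<open>\<mu>\<close> sees both, it then refutes the linearity axiom.\<close>

lemma rel_linear:
  assumes U: "\<mu> \<in> U" "\<nu> \<in> U" "\<rho> \<in> U" and r: "R m \<mu> \<nu>" "R m \<mu> \<rho>"
  shows "\<nu> = \<rho> \<or> R m \<nu> \<rho> \<or> R m \<rho> \<nu>"
proof (rule ccontr)
  assume neg: "\<not> ?thesis"
  have "\<not> \<nu> \<subseteq> \<rho> \<or> \<not> \<rho> \<subseteq> \<nu>" using neg by blast
  then have "\<exists>e\<in>carr A. e \<in> \<nu> \<and> e \<notin> \<rho>"
    using U(2,3) mem_carr ultrafilter_cpl closed(3) by (metis subsetI)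
  then obtain e where e: "e \<in> carr A" "e \<in> \<nu>" "e \<notin> \<rho>" by blast
  obtain b where b: "b \<in> \<rho>" "dia_of A m b \<notin> \<nu>" using neg by (auto simp: canon_rel_def)
  obtain c where c: "c \<in> \<nu>" "dia_of A m c \<notin> \<rho>" using neg by (auto simp: canon_rel_def)
  have cc: "b \<in> carr A" "c \<in> carr A" using b c U mem_carr by blast+
  define p where "p = e \<otimes> (c \<otimes> \<ominus> dia_of A m b)"
  define q where "q = \<ominus> e \<otimes> (b \<otimes> \<ominus> dia_of A m c)"
  have pq: "p \<in> carr A" "q \<in> carr A" using e cc by (simp_all add: p_def q_def)
  have mem: "p \<in> \<tau> \<longleftrightarrow> e \<in> \<tau> \<and> c \<in> \<tau> \<and> dia_of A m b \<notin> \<tau>"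
    "q \<in> \<tau> \<longleftrightarrow> e \<notin> \<tau> \<and> b \<in> \<tau> \<and> dia_of A m c \<notin> \<tau>" if "\<tau> \<in> U" for \<tau>
    using that e cc by (simp_all add: p_def q_def ultrafilter_mem)
  have no: "\<not> (p \<in> \<tau> \<and> (q \<in> \<tau> \<or> dia_of A m q \<in> \<tau>))" "\<not> (q \<in> \<tau> \<and> (p \<in> \<tau> \<or> dia_of A m p \<in> \<tau>))"
    if t: "\<tau> \<in> U" for \<tau>
    using mem[OF t] dia_mono[OF pq(1) cc(2) _ t] dia_mono[OF pq(2) cc(1) _ t] mem by blast+
  have "dia_of A m p \<in> \<mu>" "dia_of A m q \<in> \<mu>"
    using dia_mem[OF r(1)] dia_mem[OF r(2)] mem U e b c by blast+
  moreover have "linearity_axiom m \<in> L" using logic by (simp add: linear_temporal_logic_def)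
  ultimately show False
    using theorem_mem[of "linearity_axiom m", OF _ pq U(1)] U(1) pq no
    by (simp add: linearity_axiom_def Imp_def Conj_def ultrafilter_mem dia_iff[OF U(1)])
qed

end

section \<open>Connected components and their suprema\<close>

locale component = tense_algebra L A for L and A :: "(tense, 'a) bao" +
  fixes \<mu>\<^sub>0 :: "'a set"
  assumes root: "\<mu>\<^sub>0 \<in> ultrafilters A"
begin

text \<open>The component of the point where a formula is to be verified.  It is closed under both
  relations and, by linearity, any two distinct points of it are comparable.\<close>

definition C where "C = {x \<in> U. x = \<mu>\<^sub>0 \<or> R Fut \<mu>\<^sub>0 x \<or> R Past \<mu>\<^sub>0 x}"

lemma C_U [simp]: "x \<in> C \<Longrightarrow> x \<in> U"
  by (simp add: C_def)

lemma root_C: "\<mu>\<^sub>0 \<in> C"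
  using root by (simp add: C_def del: C_U)

lemma C_iff: "x \<in> C \<longleftrightarrow> x \<in> U \<and> (x = \<mu>\<^sub>0 \<or> R m \<mu>\<^sub>0 x \<or> R (opp m) \<mu>\<^sub>0 x)"
  by (cases m) (auto simp: C_def simp del: C_U)

lemma opp_C: "x \<in> C \<Longrightarrow> y \<in> C \<Longrightarrow> R (opp m) y x \<longleftrightarrow> R m x y"
  by (simp add: rel_opp)

lemma trans_C: "x \<in> C \<Longrightarrow> y \<in> C \<Longrightarrow> z \<in> C \<Longrightarrow> R m x y \<Longrightarrow> R m y z \<Longrightarrow> R m x z"
  using rel_trans[of x y z m] by simp

lemma C_step:
  assumes x: "x \<in> C" and y: "y \<in> U" and r: "R m x y"
  shows "y \<in> C"
proof -
  have xU: "x \<in> U" using x by simp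
  consider "x = \<mu>\<^sub>0" | "R m \<mu>\<^sub>0 x" | "R (opp m) \<mu>\<^sub>0 x" using x C_iff[of x m] by blast
  then have "y = \<mu>\<^sub>0 \<or> R m \<mu>\<^sub>0 y \<or> R (opp m) \<mu>\<^sub>0 y"
  proof cases
    case 3
    then have "R m x \<mu>\<^sub>0" using rel_opp[OF xU root, of m] by simp
    then show ?thesis
      using rel_linear[OF xU root y _ r] rel_opp[OF y root, of m] by auto
  qed (use r rel_trans[OF root xU y _ r] in auto)
  then show ?thesis using y C_iff[of y m] by blast
qed

lemma total_C:
  assumes x: "x \<in> C" and y: "y \<in> C"
  shows "x = y \<or> R m x y \<or> R m y x"
proof -
  note xU = C_U[OF x] and yU = C_U[OF y]
  have conv: "R m x \<mu>\<^sub>0 \<longleftrightarrow> R (opp m) \<mu>\<^sub>0 x" "R m y \<mu>\<^sub>0 \<longleftrightarrow> R (opp m) \<mu>\<^sub>0 y"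
    "R (opp m) x y \<longleftrightarrow> R m y x" "R (opp m) y x \<longleftrightarrow> R m x y"
    using rel_opp xU yU root by blast+
  show ?thesis
    using x[unfolded C_iff[of x m]] y[unfolded C_iff[of y m]] conv
      rel_linear[OF root xU yU, of m] rel_linear[OF root xU yU, of "opp m"]
      rel_trans[OF xU root yU, of m] rel_trans[OF yU root xU, of m] by metis
qed

definition upper where "upper m Y u \<longleftrightarrow> (\<forall>z\<in>Y. z = u \<or> R m z u)"

definition is_sup where
  "is_sup m Y s \<longleftrightarrow> s \<in> C \<and> upper m Y s \<and> (\<forall>u\<in>C. upper m Y u \<longrightarrow> s = u \<or> R m s u)"

text \<open>Components are Dedekind complete.  If \<open>Y\<close> has no last cluster, the elements that eventually
  hold along \<open>Y\<close> form a proper filter, and any ultrafilter extending it is a supremum of \<open>Y\<close> in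
  the topological closure of \<open>Y\<close>.\<close>

lemma sup_exists:
  assumes Y: "Y \<subseteq> C" "Y \<noteq> {}"
  obtains s where "is_sup m Y s" "\<And>a. a \<in> s \<Longrightarrow> \<exists>z\<in>Y. a \<in> z"
proof (cases "\<exists>z\<in>Y. upper m Y z")
  case True
  then obtain z where z: "z \<in> Y" "upper m Y z" by blast
  then have "is_sup m Y z" using Y by (auto simp: is_sup_def upper_def)
  then show thesis using that z(1) by blast
next
  case False
  have next_pt: "\<exists>y\<in>Y. R m z y \<and> \<not> R m y z \<and> y \<noteq> z" if zY: "z \<in> Y" for z
  proof -
    obtain y where y: "y \<in> Y" "y \<noteq> z" "\<not> R m y z" using False zY unfolding upper_def by blast
    then have "R m z y" using total_C[of y z m] zY Y(1) by blast
    then show ?thesis using y by blast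
  qed
  define F where "F = {a \<in> carr A. \<exists>z\<in>Y. \<forall>y\<in>Y. R m z y \<longrightarrow> a \<in> y}"
  have "\<exists>s. s \<in> U \<and> F \<subseteq> s"
  proof (rule ultrafilter_extension[of F])
    show "F \<subseteq> carr A" by (auto simp: F_def)
    have "\<one> \<in> F" using Y ultrafilterD(2) by (auto simp: F_def subset_iff)
    then show "F \<noteq> {}" by blast
    show "\<zero> \<notin> F"
    proof
      assume "\<zero> \<in> F"
      then obtain z where "z \<in> Y" "\<forall>y\<in>Y. R m z y \<longrightarrow> \<zero> \<in> y" by (auto simp: F_def)
      then obtain y where "y \<in> Y" "\<zero> \<in> y" using next_pt by blast
      then show False using ultrafilterD(3) Y C_U by blast
    qed
    show "a \<otimes> b \<in> F" if "a \<in> F" "b \<in> F" for a b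
    proof -
      have c: "a \<in> carr A" "b \<in> carr A" using that by (auto simp: F_def)
      obtain v w where vw: "v \<in> Y" "\<forall>y\<in>Y. R m v y \<longrightarrow> a \<in> y" "w \<in> Y" "\<forall>y\<in>Y. R m w y \<longrightarrow> b \<in> y"
        using \<open>a \<in> F\<close> \<open>b \<in> F\<close> by (auto simp: F_def)
      have vC: "v \<in> C" "w \<in> C" using vw Y by auto
      have "\<exists>z\<in>Y. \<forall>y\<in>Y. R m z y \<longrightarrow> R m v y \<and> R m w y"
      proof -
        have "R m v y" if "y \<in> Y" "R m v w \<or> v = w" "R m w y" for y
          using that trans_C[OF vC, of y m] Y(1) by blast
        moreover have "R m w y" if "y \<in> Y" "R m w v \<or> v = w" "R m v y" for y
          using that trans_C[OF vC(2,1), of y m] Y(1) by blast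
        ultimately show ?thesis using total_C[OF vC, of m] vw(1,3) by metis
      qed
      then obtain z where "z \<in> Y" "\<forall>y\<in>Y. R m z y \<longrightarrow> a \<in> y \<and> b \<in> y" using vw by blast
      moreover have "a \<otimes> b \<in> y" if "y \<in> Y" "a \<in> y" "b \<in> y" for y
        using that Y(1) c by (auto simp: ultrafilter_mem)
      ultimately show ?thesis using c unfolding F_def by auto
    qed
  qed blast
  then obtain s where s: "s \<in> U" "F \<subseteq> s" by blast
  have cofinal: "\<exists>y\<in>Y. R m z y \<and> a \<in> y" if "a \<in> s" "z \<in> Y" for a z
  proof (rule ccontr)
    assume no: "\<not> ?thesis"
    have ca: "a \<in> carr A" using that(1) s(1) mem_carr by blast
    have "\<ominus> a \<in> F" using that(2) no ca Y by (auto simp: F_def ultrafilter_mem subset_iff)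
    then show False using s that(1) ca ultrafilter_cpl[OF s(1) ca] by auto
  qed
  have below: "R m z s" if "z \<in> Y" for z
    unfolding canon_rel_def using cofinal[OF _ that] dia_mem by blast
  have sC: "s \<in> C" using C_step[OF _ s(1) below] Y by blast
  have near: "\<exists>z\<in>Y. a \<in> z" if "a \<in> s" for a using cofinal[OF that] Y(2) by blast
  have "R m s u" if u: "u \<in> C" "upper m Y u" for u
    unfolding canon_rel_def
  proof
    fix a assume a: "a \<in> u"
    then have ca: "a \<in> carr A" by (rule mem_carr[OF C_U[OF u(1)]])
    show "dia_of A m a \<in> s"
    proof (rule ccontr)
      assume "dia_of A m a \<notin> s"
      then have "\<ominus> dia_of A m a \<in> s" using ca s by (simp add: ultrafilter_mem)
      then obtain z where z: "z \<in> Y" "\<ominus> dia_of A m a \<in> z" using near by blast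
      have zC: "z \<in> C" using z Y by blast
      obtain y where y: "y \<in> Y" "R m z y" using next_pt z by blast
      have "y = u \<or> R m y u" using u(2) y(1) unfolding upper_def by blast
      then have "R m z u" using y trans_C[OF zC _ u(1), of y m] Y(1) by auto
      then have "dia_of A m a \<in> z" using a dia_mem by blast
      then show False using z(2) zC ca by (simp add: ultrafilter_mem)
    qed
  qed
  then have "is_sup m Y s" using sC below by (auto simp: is_sup_def upper_def)
  then show thesis using that near by blast
qed

text \<open>Since suprema lie in the closure, an element that holds somewhere in the component holds at a
  last point, up to clusters, and at a first one.\<close>

definition is_last where
  "is_last m a s \<longleftrightarrow> s \<in> C \<and> a \<in> s \<and> (\<forall>y\<in>C. a \<in> y \<longrightarrow> y = s \<or> R m y s)"

lemma last_exists:
  assumes a: "a \<in> carr A" and y: "y \<in> C" "a \<in> y"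
  obtains s where "is_last m a s"
proof -
  obtain s where s: "is_sup m {y \<in> C. a \<in> y} s" "\<And>b. b \<in> s \<Longrightarrow> \<exists>z\<in>{y \<in> C. a \<in> y}. b \<in> z"
    using sup_exists[of "{y \<in> C. a \<in> y}" m] y by blast
  have sC: "s \<in> C" using s by (simp add: is_sup_def)
  have "a \<in> s"
  proof (rule ccontr)
    assume "a \<notin> s"
    then have "\<ominus> a \<in> s" using a sC by (simp add: ultrafilter_mem)
    then obtain z where "z \<in> C" "a \<in> z" "\<ominus> a \<in> z" using s(2) by blast
    then show False using a by (simp add: ultrafilter_mem)
  qed
  then have "is_last m a s" using s(1) sC by (auto simp: is_last_def is_sup_def upper_def)
  then show thesis using that by blast
qed

end

section \<open>Countable Skolem hulls\<close>

text \<open>The downward Loewenheim--Skolem argument in the form needed: countably many ternary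
  relations, each of which requests a witness \<open>z\<close> for parameters \<open>x\<close> and \<open>y\<close>.\<close>

lemma skolem_hull:
  fixes X\<^sub>0 :: "'x set" and \<P> :: "('x \<Rightarrow> 'x \<Rightarrow> 'x \<Rightarrow> bool) set"
  assumes X0: "countable X\<^sub>0" and P: "countable \<P>"
  obtains X where "countable X" "X\<^sub>0 \<subseteq> X"
    "\<And>P x y z. P \<in> \<P> \<Longrightarrow> x \<in> X \<Longrightarrow> y \<in> X \<Longrightarrow> P x y z \<Longrightarrow> \<exists>z\<in>X. P x y z"
proof -
  define F where "F X = X \<union> (\<lambda>(P, x, y). SOME z. P x y z) ` (\<P> \<times> X \<times> X)" for X
  define S where "S n = (F ^^ n) X\<^sub>0" for n
  have S: "S 0 = X\<^sub>0" "S (Suc n) = F (S n)" for n by (simp_all add: S_def)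
  have "countable (S n)" for n
    by (induction n) (use X0 P in \<open>simp_all add: S F_def\<close>)
  then have cnt: "countable (\<Union>n. S n)" by blast
  have mono: "S i \<subseteq> S j" if "i \<le> j" for i j
    using that by (rule lift_Suc_mono_le[rotated]) (auto simp: S F_def)
  have closed: "\<exists>z\<in>(\<Union>n. S n). P x y z"
    if P1: "P \<in> \<P>" and xy: "x \<in> (\<Union>n. S n)" "y \<in> (\<Union>n. S n)" and P2: "P x y z" for P x y z
  proof -
    from xy obtain i j where "x \<in> S i" "y \<in> S j" by blast
    then have "x \<in> S (max i j)" "y \<in> S (max i j)"
      using mono[of i "max i j"] mono[of j "max i j"] by auto
    then have "(SOME z. P x y z) \<in> S (Suc (max i j))"
      unfolding S F_def using P1 by (intro UnI2 image_eqI[of _ _ "(P, x, y)"]) auto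
    moreover have "P x y (SOME z. P x y z)" using P2 by (rule someI)
    ultimately show ?thesis by blast
  qed
  show thesis
  proof (rule that[OF cnt])
    show "X\<^sub>0 \<subseteq> (\<Union>n. S n)" using S(1) by blast
  qed (rule closed)
qed

text \<open>The hull below mixes ultrafilters and algebra elements in one sum type; the injections
  \<open>i\<close>, \<open>j\<close>, \<open>k\<close> say which sort each argument has.\<close>

definition lift_rel where
  "lift_rel i j k Q = (\<lambda>u v w. \<exists>x y z. u = i x \<and> v = j y \<and> w = k z \<and> Q x y z)"

context component
begin

definition between where
  "between col c d S = {z \<in> C. R Fut c z \<and> R Fut z d \<and> col z \<in> S}"

end

text \<open>A countable set \<open>W\<close> of points and a countable subalgebra \<open>B\<close> that know enough about the
  component.  The finite colouring \<open>col\<close> will record which subformulas of a given formula are true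
  at a point.  The last conditions say that \<open>W\<close> contains witnesses for coloured points in intervals
  with endpoints in \<open>W\<close>, their suprema, and the extreme points of the elements of \<open>B\<close>;
  \<open>separate\<close> and \<open>separate_rel\<close> make \<open>B\<close> large enough to see the structure of \<open>W\<close>.\<close>

locale hull = component L A \<mu>\<^sub>0 for L and A :: "(tense, 'a) bao" and \<mu>\<^sub>0 +
  fixes col :: "'a set \<Rightarrow> 'c" and W :: "'a set set" and B :: "'a set"
  assumes finite_col: "finite (col ` C)"
    and countable_B: "countable B" and B_carr: "B \<subseteq> carr A"
    and zero_B: "\<zero> \<in> B" and one_B: "\<one> \<in> B"
    and join_B: "a \<in> B \<Longrightarrow> b \<in> B \<Longrightarrow> a \<oplus> b \<in> B" and meet_B: "a \<in> B \<Longrightarrow> b \<in> B \<Longrightarrow> a \<otimes> b \<in> B"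
    and cpl_B: "a \<in> B \<Longrightarrow> \<ominus> a \<in> B" and dia_B: "a \<in> B \<Longrightarrow> dia_of A m a \<in> B"
    and W_C: "W \<subseteq> C" and root_W: "\<mu>\<^sub>0 \<in> W"
    and separate: "x \<in> W \<Longrightarrow> y \<in> W \<Longrightarrow> x \<noteq> y \<Longrightarrow> \<exists>a\<in>B. a \<in> x \<and> a \<notin> y"
    and separate_rel: "x \<in> W \<Longrightarrow> y \<in> W \<Longrightarrow> \<not> R m x y \<Longrightarrow> \<exists>a\<in>B. a \<in> y \<and> dia_of A m a \<notin> x"
    and beyond: "c \<in> W \<Longrightarrow> z \<in> C \<Longrightarrow> R m c z \<Longrightarrow> \<exists>z'\<in>W. R m c z' \<and> col z' = col z"
    and inside: "c \<in> W \<Longrightarrow> d \<in> W \<Longrightarrow> S \<subseteq> col ` C \<Longrightarrow> between col c d S \<noteq> {} \<Longrightarrow>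
      \<exists>z\<in>W. z \<in> between col c d S"
    and sup_W: "c \<in> W \<Longrightarrow> d \<in> W \<Longrightarrow> S \<subseteq> col ` C \<Longrightarrow> between col c d S \<noteq> {} \<Longrightarrow>
      \<exists>s\<in>W. is_sup Fut (between col c d S) s"
    and last_W: "a \<in> B \<Longrightarrow> y \<in> C \<Longrightarrow> a \<in> y \<Longrightarrow> \<exists>s\<in>W. is_last m a s"

lemma (in component) hull_exists:
  fixes col :: "'a set \<Rightarrow> 'c"
  assumes col: "finite (col ` C)"
  obtains W B where "hull L A \<mu>\<^sub>0 col W B"
proof -
  define K where "K = col ` C"
  have K: "finite K" using col by (simp add: K_def)
  define \<P>\<^sub>1 :: "('a set + 'a \<Rightarrow> 'a set + 'a \<Rightarrow> 'a set + 'a \<Rightarrow> bool) set" where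
    "\<P>\<^sub>1 = (\<lambda>(m, t). lift_rel Inl Inl Inl (\<lambda>c d z. z \<in> C \<and> R m c z \<and> col z = t)) ` (UNIV \<times> K)"
  define \<P>\<^sub>2 :: "('a set + 'a \<Rightarrow> 'a set + 'a \<Rightarrow> 'a set + 'a \<Rightarrow> bool) set" where
    "\<P>\<^sub>2 = (\<lambda>S. lift_rel Inl Inl Inl (\<lambda>c d z. z \<in> between col c d S)) ` Pow (K)"
  define \<P>\<^sub>3 :: "('a set + 'a \<Rightarrow> 'a set + 'a \<Rightarrow> 'a set + 'a \<Rightarrow> bool) set" where
    "\<P>\<^sub>3 = (\<lambda>S. lift_rel Inl Inl Inl (\<lambda>c d. is_sup Fut (between col c d S))) ` Pow (K)"
  define \<P>\<^sub>4 :: "('a set + 'a \<Rightarrow> 'a set + 'a \<Rightarrow> 'a set + 'a \<Rightarrow> bool) set" where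
    "\<P>\<^sub>4 = range (\<lambda>m. lift_rel Inr Inr Inl (\<lambda>a b. is_last m a))"
  define \<P>\<^sub>5 :: "('a set + 'a \<Rightarrow> 'a set + 'a \<Rightarrow> 'a set + 'a \<Rightarrow> bool) set" where
    "\<P>\<^sub>5 = insert (lift_rel Inl Inl Inr (\<lambda>x y a. a \<in> carr A \<and> a \<in> x \<and> a \<notin> y))
      (range (\<lambda>m. lift_rel Inl Inl Inr (\<lambda>x y a. a \<in> carr A \<and> a \<in> y \<and> dia_of A m a \<notin> x)))"
  define \<P>\<^sub>6 :: "('a set + 'a \<Rightarrow> 'a set + 'a \<Rightarrow> 'a set + 'a \<Rightarrow> bool) set" where
    "\<P>\<^sub>6 = (\<lambda>f. lift_rel Inr Inr Inr (\<lambda>a b c. c = f a b)) `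
      ({plus_of A, times_of A, \<lambda>a b. \<ominus> a} \<union> range (\<lambda>m a b. dia_of A m a))"
  define \<P> where "\<P> = \<P>\<^sub>1 \<union> \<P>\<^sub>2 \<union> \<P>\<^sub>3 \<union> \<P>\<^sub>4 \<union> \<P>\<^sub>5 \<union> \<P>\<^sub>6"
  have sub: "\<P>\<^sub>1 \<subseteq> \<P>" "\<P>\<^sub>2 \<subseteq> \<P>" "\<P>\<^sub>3 \<subseteq> \<P>" "\<P>\<^sub>4 \<subseteq> \<P>" "\<P>\<^sub>5 \<subseteq> \<P>" "\<P>\<^sub>6 \<subseteq> \<P>"
    unfolding \<P>_def by blast+
  have "countable \<P>"
    unfolding \<P>_def \<P>\<^sub>1_def \<P>\<^sub>2_def \<P>\<^sub>3_def \<P>\<^sub>4_def \<P>\<^sub>5_def \<P>\<^sub>6_def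
    using K by (intro countable_Un countable_image countable_insert countable_SIGMA)
      (auto intro: countable_finite)
  then obtain X where cX: "countable X" and X0: "{Inl \<mu>\<^sub>0, Inr \<zero>, Inr \<one>} \<subseteq> X"
    and X: "\<And>P x y z. P \<in> \<P> \<Longrightarrow> x \<in> X \<Longrightarrow> y \<in> X \<Longrightarrow> P x y z \<Longrightarrow> \<exists>z\<in>X. P x y z"
    using skolem_hull[of "{Inl \<mu>\<^sub>0, Inr \<zero>, Inr \<one>}" \<P>] by (metis countable_empty countable_insert)
  define W where "W = {x \<in> C. Inl x \<in> X}"
  define B where "B = {a \<in> carr A. Inr a \<in> X}"
  have pp: "\<exists>z. Inl z \<in> X \<and> Q x y z"
    if "lift_rel Inl Inl Inl Q \<in> \<P>" "x \<in> W" "y \<in> W" "Q x y z" for Q x y z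
    using X[OF that(1), of "Inl x" "Inl y" "Inl z"] that by (auto simp: W_def lift_rel_def)
  have pe: "\<exists>z. Inr z \<in> X \<and> Q x y z"
    if "lift_rel Inl Inl Inr Q \<in> \<P>" "x \<in> W" "y \<in> W" "Q x y z" for Q x y z
    using X[OF that(1), of "Inl x" "Inl y" "Inr z"] that by (auto simp: W_def lift_rel_def)
  have ep: "\<exists>z. Inl z \<in> X \<and> Q x y z"
    if "lift_rel Inr Inr Inl Q \<in> \<P>" "x \<in> B" "y \<in> B" "Q x y z" for Q x y z
    using X[OF that(1), of "Inr x" "Inr y" "Inl z"] that by (auto simp: B_def lift_rel_def)
  have ee: "Inr (f x y) \<in> X"
    if "lift_rel Inr Inr Inr (\<lambda>a b c. c = f a b) \<in> \<P>" "x \<in> B" "y \<in> B" for f x y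
    using X[OF that(1), of "Inr x" "Inr y" "Inr (f x y)"] that by (auto simp: B_def lift_rel_def)
  have "hull L A \<mu>\<^sub>0 col W B"
  proof unfold_locales
    show "finite (col ` C)" by (fact col)
    have "countable (Inr ` B :: ('a set + 'a) set)"
      by (rule countable_subset[OF _ cX]) (auto simp: B_def)
    then show "countable B" by (rule countable_image_inj_on) simp
    show "B \<subseteq> carr A" "\<zero> \<in> B" "\<one> \<in> B" using X0 closed(1,2) unfolding B_def by blast+
    show "W \<subseteq> C" "\<mu>\<^sub>0 \<in> W" using X0 root_C unfolding W_def by blast+
    have P6: "lift_rel Inr Inr Inr (\<lambda>a b c. c = f a b) \<in> \<P>"
      if "f \<in> {plus_of A, times_of A, \<lambda>a b. \<ominus> a} \<union> range (\<lambda>m a b. dia_of A m a)" for f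
      by (rule subsetD[OF sub(6)], unfold \<P>\<^sub>6_def, rule image_eqI[where x = f], rule refl, rule that)
    show "a \<oplus> b \<in> B" if "a \<in> B" "b \<in> B" for a b
      using ee[OF P6, of "plus_of A" a b] that by (simp add: B_def)
    show "a \<otimes> b \<in> B" if "a \<in> B" "b \<in> B" for a b
      using ee[OF P6, of "times_of A" a b] that by (simp add: B_def)
    show "\<ominus> a \<in> B" if "a \<in> B" for a
      using ee[OF P6, of "\<lambda>a b. \<ominus> a" a a] that by (simp add: B_def)
    show "dia_of A m a \<in> B" if "a \<in> B" for m a
      using ee[OF P6, of "\<lambda>a b. dia_of A m a" a a] that by (simp add: B_def)
    show "\<exists>a\<in>B. a \<in> x \<and> a \<notin> y" if xy: "x \<in> W" "y \<in> W" "x \<noteq> y" for x y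
    proof -
      have U: "x \<in> U" "y \<in> U" using xy by (auto simp: W_def)
      have "\<exists>a. a \<in> carr A \<and> a \<in> x \<and> a \<notin> y"
      proof (rule ccontr)
        assume no: "\<not> ?thesis"
        have "a \<in> x" if "a \<in> y" for a
          using no that U mem_carr[OF U(2) that] ultrafilter_cpl closed(3) by metis
        then show False using no xy(3) mem_carr[OF U(1)] by blast
      qed
      moreover have "lift_rel Inl Inl Inr (\<lambda>x y a. a \<in> carr A \<and> a \<in> x \<and> a \<notin> y) \<in> \<P>"
        by (rule subsetD[OF sub(5)], unfold \<P>\<^sub>5_def, rule insertI1)
      ultimately show ?thesis using pe[OF _ xy(1,2)] unfolding B_def by blast
    qed
    show "\<exists>a\<in>B. a \<in> y \<and> dia_of A m a \<notin> x" if xy: "x \<in> W" "y \<in> W" and r: "\<not> R m x y" for x y m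
    proof -
      have "\<exists>a. a \<in> carr A \<and> a \<in> y \<and> dia_of A m a \<notin> x"
        using r mem_carr[of y] xy(2) unfolding canon_rel_def W_def using C_U by blast
      moreover have "lift_rel Inl Inl Inr (\<lambda>x y a. a \<in> carr A \<and> a \<in> y \<and> dia_of A m a \<notin> x) \<in> \<P>"
        by (rule subsetD[OF sub(5)], unfold \<P>\<^sub>5_def, rule insertI2, rule range_eqI[where x = m],
            rule refl)
      ultimately show ?thesis using pe[OF _ xy] unfolding B_def by blast
    qed
    show "\<exists>z'\<in>W. R m c z' \<and> col z' = col z" if c: "c \<in> W" and z: "z \<in> C" "R m c z" for c z m
    proof -
      have "lift_rel Inl Inl Inl (\<lambda>c d z'. z' \<in> C \<and> R m c z' \<and> col z' = col z) \<in> \<P>"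
        by (rule subsetD[OF sub(1)], unfold \<P>\<^sub>1_def K_def, rule image_eqI[where x = "(m, col z)"])
          (use z(1) in simp_all)
      then show ?thesis using pp[OF _ c c, of _ z] z unfolding W_def by blast
    qed
    fix c d S assume *: "c \<in> W" "d \<in> W" "S \<subseteq> col ` C" "between col c d S \<noteq> {}"
    have bC: "between col c d S \<subseteq> C" by (auto simp: between_def)
    have "lift_rel Inl Inl Inl (\<lambda>c d z. z \<in> between col c d S) \<in> \<P>"
      by (rule subsetD[OF sub(2)], unfold \<P>\<^sub>2_def K_def, rule image_eqI[where x = S], rule refl)
        (use *(3) in blast)
    then show "\<exists>z\<in>W. z \<in> between col c d S"
      using pp[OF _ *(1,2)] *(4) bC unfolding W_def by blast
    obtain s where "is_sup Fut (between col c d S) s" using sup_exists[OF bC *(4)] by blast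
    moreover have "lift_rel Inl Inl Inl (\<lambda>c d. is_sup Fut (between col c d S)) \<in> \<P>"
      by (rule subsetD[OF sub(3)], unfold \<P>\<^sub>3_def K_def, rule image_eqI[where x = S], rule refl)
        (use *(3) in blast)
    ultimately obtain s where "Inl s \<in> X" "is_sup Fut (between col c d S) s"
      using pp[OF _ *(1,2)] by blast
    then show "\<exists>s\<in>W. is_sup Fut (between col c d S) s" by (auto simp: W_def is_sup_def)
  next
    show "\<exists>s\<in>W. is_last m a s" if a: "a \<in> B" and y: "y \<in> C" "a \<in> y" for a y m
    proof -
      obtain s where "is_last m a s" using last_exists[OF _ y] a by (auto simp: B_def)
      moreover have "lift_rel Inr Inr Inl (\<lambda>a b. is_last m a) \<in> \<P>"
        by (rule subsetD[OF sub(4)], unfold \<P>\<^sub>4_def, rule range_eqI[where x = m], rule refl)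
      ultimately obtain s where "Inl s \<in> X" "is_last m a s" using ep[OF _ a a] by blast
      then show ?thesis by (auto simp: W_def is_last_def)
    qed
  qed
  then show thesis by (rule that)
qed

section \<open>The frame of the subalgebra and its gaps\<close>

context hull
begin

definition A' where "A' = A\<lparr>carr := B\<rparr>"

lemma A'_simps [simp]:
  "carr A' = B" "plus_of A' = plus_of A" "times_of A' = times_of A" "compl_of A' = compl_of A"
  "zero_of A' = \<zero>" "one_of A' = \<one>" "dia_of A' = dia_of A"
  by (simp_all add: A'_def)

lemma eval_A': "eval A' v \<phi> = eval A v \<phi>"
  by (induction \<phi>) simp_all

lemma A'_variety: "A' \<in> variety L"
proof -
  have "is_bao A'"
    unfolding is_bao_def A'_simps
  proof (intro conjI allI ballI)
    fix x y z m
    assume "x \<in> B" "y \<in> B" "z \<in> B"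
    then have "x \<in> carr A" "y \<in> carr A" "z \<in> carr A" using B_carr by blast+
    then show "x \<oplus> y \<otimes> z = (x \<oplus> y) \<otimes> (x \<oplus> z)" "x \<otimes> (y \<oplus> z) = x \<otimes> y \<oplus> x \<otimes> z"
      by (rule distribs)+
  next
    fix x y m
    assume "x \<in> B" "y \<in> B"
    then have c: "x \<in> carr A" "y \<in> carr A" using B_carr by blast+
    show "x \<oplus> y = y \<oplus> x" "x \<otimes> y = y \<otimes> x"
      "dia_of A m (x \<oplus> y) = dia_of A m x \<oplus> dia_of A m y"
      by (rule huntington[OF c])+
  next
    fix x
    assume "x \<in> B"
    then have c: "x \<in> carr A" using B_carr by blast
    show "x \<oplus> \<zero> = x" "x \<otimes> \<one> = x" "x \<oplus> \<ominus> x = \<one>" "x \<otimes> \<ominus> x = \<zero>"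
      by (rule huntington[OF c c])+
  next
    fix m show "dia_of A m \<zero> = \<zero>" by (rule huntington[OF closed(1) closed(1)])
  qed (simp_all add: zero_B one_B join_B meet_B cpl_B dia_B)
  moreover have "eval A' v \<phi> = one_of A'" if "\<phi> \<in> L" "range v \<subseteq> B" for \<phi> v
    using variety that B_carr unfolding variety_def eval_A' A'_simps by blast
  ultimately show ?thesis by (simp add: variety_def)
qed

sublocale sub: tense_algebra L A'
  using logic A'_variety by unfold_locales

lemma A'_rel [simp]: "canon_rel A' = R"
  by (intro ext) (simp add: canon_rel_def)

lemma restrict_ultrafilter:
  assumes x: "x \<in> U"
  shows "x \<inter> B \<in> ultrafilters A'"
  unfolding ultrafilters_def A'_simps mem_Collect_eq
proof (intro conjI ballI impI)
  show "\<one> \<in> x \<inter> B" "\<zero> \<notin> x \<inter> B" using ultrafilterD[OF x] one_B by auto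
  show "a \<otimes> b \<in> x \<inter> B" if "a \<in> x \<inter> B" "b \<in> x \<inter> B" for a b
    using that meet_B ultrafilter_meet[OF x] B_carr by (simp add: subset_iff)
  show "b \<in> x \<inter> B" if "a \<in> x \<inter> B" "b \<in> B" "a \<otimes> b = a" for a b
    using that ultrafilter_meet[OF x, of a b] B_carr by auto
  show "a \<in> x \<inter> B \<or> \<ominus> a \<in> x \<inter> B" if "a \<in> B" for a
    using that ultrafilter_cpl[OF x, of a] B_carr cpl_B by auto
qed simp

text \<open>The relation of the canonical frame of \<open>A'\<close>, pulled back along the restriction of
  ultrafilters from \<open>A\<close> to \<open>B\<close>.\<close>

definition Q where "Q m x y \<longleftrightarrow> R m (x \<inter> B) (y \<inter> B)"

lemma Q_iff: "Q m x y \<longleftrightarrow> (\<forall>a\<in>B. a \<in> y \<longrightarrow> dia_of A m a \<in> x)"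
  using dia_B by (auto simp: Q_def canon_rel_def)

lemma R_Q: "R m x y \<Longrightarrow> Q m x y"
  by (simp add: Q_iff canon_rel_def)

lemma Q_opp: "x \<in> C \<Longrightarrow> y \<in> C \<Longrightarrow> Q (opp m) y x \<longleftrightarrow> Q m x y"
  unfolding Q_def
  using sub.rel_opp[OF restrict_ultrafilter[of x] restrict_ultrafilter[of y], of m] by simp

lemma Q_trans:
  assumes "x \<in> C" "y \<in> C" "z \<in> C" and "Q m x y" "Q m y z"
  shows "Q m x z"
  using sub.rel_trans[OF restrict_ultrafilter[of x] restrict_ultrafilter[of y]
      restrict_ultrafilter[of z], of m] assms by (simp add: Q_def)

lemma W_C' [simp]: "w \<in> W \<Longrightarrow> w \<in> C"
  using W_C by blast

lemma W_Q: "x \<in> W \<Longrightarrow> y \<in> W \<Longrightarrow> Q m x y \<longleftrightarrow> R m x y"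
  using separate_rel[of x y m] R_Q[of m x y] unfolding Q_iff by blast

lemma W_eq: "x \<in> W \<Longrightarrow> y \<in> W \<Longrightarrow> x \<inter> B = y \<inter> B \<Longrightarrow> x = y"
  using separate[of x y] by blast

text \<open>Restriction is a bounded morphism.  Hence all points seen from the restriction of a point of
  \<open>C\<close> are again such restrictions, and the small frame can be studied on \<open>C\<close> through \<open>Q\<close>.\<close>

lemma restrict_bounded:
  assumes x: "x \<in> C" and \<nu>: "\<nu> \<in> ultrafilters A'" and r: "R m (x \<inter> B) \<nu>"
  obtains y where "y \<in> C" "R m x y" "y \<inter> B = \<nu>"
proof -
  have \<nu>B: "\<nu> \<subseteq> B" using sub.ultrafilterD(1)[OF \<nu>] by simp
  have "\<exists>y. y \<in> U \<and> \<nu> \<subseteq> y \<and> R m x y"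
  proof (rule successor_extension[of x \<nu> m])
    show "x \<in> U" using x by simp
    show "\<nu> \<subseteq> carr A" using \<nu>B B_carr by blast
    show "\<nu> \<noteq> {}" using sub.ultrafilterD(2)[OF \<nu>] by blast
    show "a \<otimes> b \<in> \<nu>" if "a \<in> \<nu>" "b \<in> \<nu>" for a b
      using sub.ultrafilter_meet[OF \<nu>, of a b] that \<nu>B by auto
    show "dia_of A m a \<in> x" if "a \<in> \<nu>" for a
      using r that by (simp add: canon_rel_def)
  qed blast
  then obtain y where y: "y \<in> U" "\<nu> \<subseteq> y" "R m x y" by blast
  have "a \<in> \<nu>" if "a \<in> y" "a \<in> B" for a
    using sub.ultrafilter_cpl[OF \<nu>, of a] ultrafilter_cpl[OF y(1), of a] that y(2) B_carr by auto
  then have "y \<inter> B = \<nu>" using y(2) \<nu>B by blast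
  then show thesis using that[OF C_step[OF x y(1,3)] y(3)] by blast
qed

text \<open>For the small frame, a point near \<open>w\<close> is indistinguishable by its position: it restricts
  to the same ultrafilter as \<open>w\<close> or lies in the same cluster.  The remaining points are gap points;
  each of them only cuts \<open>W\<close> into a lower and an upper part.\<close>

definition near where
  "near w x \<longleftrightarrow> w \<in> W \<and> (\<forall>m. \<forall>y\<in>C. Q m x y \<longleftrightarrow> Q m w y)"

definition gap where "gap x \<longleftrightarrow> x \<in> C \<and> (\<forall>w. \<not> near w x)"

lemma gap_C [simp]: "gap x \<Longrightarrow> x \<in> C"
  by (simp add: gap_def)

lemma near_Q:
  assumes n: "near w x" and C: "x \<in> C" "y \<in> C"
  shows "Q m x y \<longleftrightarrow> Q m w y" "Q m y x \<longleftrightarrow> Q m y w"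
proof -
  have w: "w \<in> C" using n W_C unfolding near_def by blast
  show "Q m x y \<longleftrightarrow> Q m w y" using n C unfolding near_def by blast
  have "Q (opp m) x y \<longleftrightarrow> Q (opp m) w y" using n C(2) unfolding near_def by blast
  then show "Q m y x \<longleftrightarrow> Q m y w" using Q_opp[OF C(2,1)] Q_opp[OF C(2) w] by simp
qed

lemma gap_cut:
  assumes x: "gap x" and w: "w \<in> W"
  shows gap_neq: "x \<noteq> w" and gap_dichotomy: "Q m w x \<longleftrightarrow> \<not> Q m x w"
    and gap_R: "Q m w x \<longleftrightarrow> R m w x"
proof -
  have C: "x \<in> C" "w \<in> C" using x w by auto
  have "near w w" using w unfolding near_def by blast
  then show neq: "x \<noteq> w" using x unfolding gap_def by blast
  have no: "\<not> (Q m x w \<and> Q m w x)"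
  proof
    assume q: "Q m x w \<and> Q m w x"
    have q': "Q n x w \<and> Q n w x" for n
    proof (cases "n = m")
      case False
      then have "n = opp m" by (cases n; cases m) auto
      then show ?thesis using q Q_opp[OF C] Q_opp[OF C(2,1)] by simp
    qed (use q in simp)
    have "near w x"
      unfolding near_def using w q' Q_trans[OF C] Q_trans[OF C(2,1)] by blast
    then show False using x by (simp add: gap_def)
  qed
  then show "Q m w x \<longleftrightarrow> \<not> Q m x w" "Q m w x \<longleftrightarrow> R m w x"
    using total_C[OF C, of m] neq R_Q by blast+
qed

lemma gap_below:
  assumes x: "gap x"
  shows "\<exists>c\<in>W. Q m c x"
proof -
  obtain s where s: "s \<in> W" "is_last (opp m) \<one> s"
    using last_W[OF one_B root_C, of "opp m"] ultrafilterD(2)[OF root] by blast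
  have "\<one> \<in> x" using ultrafilterD(2) x by simp
  then have "R (opp m) x s" using s(2) gap_neq[OF x s(1)] gap_C[OF x] unfolding is_last_def by blast
  then have "R m s x" using opp_C[of s x m] s x by simp
  then show ?thesis using s R_Q by blast
qed

text \<open>A point \<open>c\<close> of \<open>W\<close> below a gap point \<open>x\<close> is separated from \<open>x\<close> by some \<open>a \<in> B\<close> that holds at
  \<open>c\<close> but no longer after \<open>x\<close>.  The first point where \<open>a\<close> neither holds nor is to come belongs
  to \<open>W\<close> and lies strictly above \<open>c\<close> and below \<open>x\<close>.\<close>

lemma gap_no_last:
  assumes x: "gap x" and c: "c \<in> W" "Q m c x"
  obtains c' where "c' \<in> W" "Q m c' x" "R m c c'" "\<not> R m c' c"
proof -
  have xU: "x \<in> U" and xC: "x \<in> C" using x by simp_all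
  obtain a where a: "a \<in> B" "a \<in> c" "dia_of A m a \<notin> x"
    using gap_dichotomy[OF x c(1), of m] c(2) unfolding Q_iff[of m x c] by blast
  have ca: "a \<in> carr A" using a B_carr by blast
  have "a \<notin> x"
  proof
    assume ax: "a \<in> x"
    then obtain s where s: "s \<in> W" "is_last m a s" using last_W[OF a(1) xC] by blast
    then have "R m x s" "a \<in> s" using gap_neq[OF x s(1)] ax xC by (auto simp: is_last_def)
    then show False using a(3) dia_mem by blast
  qed
  \<comment> \<open>\<open>b\<close> holds exactly where \<open>a\<close> neither holds nor is to come\<close>
  define b where "b = \<ominus> (a \<oplus> dia_of A m a)"
  have bB: "b \<in> B" using a by (simp add: b_def join_B cpl_B dia_B)
  have mem_b: "b \<in> y \<longleftrightarrow> a \<notin> y \<and> dia_of A m a \<notin> y" if "y \<in> U" for y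
    using that ca by (simp add: b_def ultrafilter_mem)
  have bx: "b \<in> x" using mem_b[OF xU] \<open>a \<notin> x\<close> a(3) by blast
  then obtain n where n: "n \<in> W" "is_last (opp m) b n" using last_W[OF bB xC] by blast
  have nC: "n \<in> C" "c \<in> C" using n c by simp_all
  have "R (opp m) x n" "b \<in> n" using n gap_neq[OF x n(1)] bx xC by (auto simp: is_last_def)
  then have "R m n x" "a \<notin> n" "dia_of A m a \<notin> n" using opp_C[OF nC(1) xC] mem_b C_U[OF nC(1)] by blast+
  then have "\<not> R m n c" "c \<noteq> n" "Q m n x" using a(2) dia_mem R_Q by blast+
  then show thesis using that n(1) total_C[OF nC(2,1), of m] by blast
qed

definition cofinal where
  "cofinal m x t \<longleftrightarrow> (\<forall>c\<in>W. Q m c x \<longrightarrow> (\<exists>c'\<in>W. R m c c' \<and> Q m c' x \<and> col c' = t))"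

text \<open>There are finitely many colours, so sufficiently close to the cut only cofinal ones occur.\<close>

lemma eventually_cofinal:
  assumes x: "gap x"
  obtains c where "c \<in> W" "Q m c x"
    "\<And>d. d \<in> W \<Longrightarrow> R m c d \<Longrightarrow> Q m d x \<Longrightarrow> cofinal m x (col d)"
proof -
  have "\<exists>c\<in>W. Q m c x \<and> (\<forall>d\<in>W. R m c d \<and> Q m d x \<longrightarrow> col d \<notin> T)"
    if "finite T" "\<forall>t\<in>T. \<not> cofinal m x t" for T
    using that
  proof (induction T)
    case empty
    then show ?case using gap_below[OF x] by blast
  next
    case (insert t T)
    then obtain c where c: "c \<in> W" "Q m c x" "\<forall>d\<in>W. R m c d \<and> Q m d x \<longrightarrow> col d \<notin> T" by auto
    obtain e where e: "e \<in> W" "Q m e x" "\<forall>d\<in>W. R m e d \<and> Q m d x \<longrightarrow> col d \<noteq> t"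
      using insert.prems unfolding cofinal_def by blast
    have C: "c \<in> C" "e \<in> C" using c e by simp_all
    show ?case
    proof (cases "R m c e")
      case True
      then have "R m c d" if "d \<in> W" "R m e d" for d using trans_C[OF C, of d m] that by simp
      then show ?thesis using c e by blast
    next
      case False
      then have "R m e d" if "d \<in> W" "R m c d" for d
        using trans_C[OF C(2,1), of d m] that total_C[OF C, of m] by auto
      then show ?thesis using c e by blast
    qed
  qed
  moreover have "finite {t \<in> col ` C. \<not> cofinal m x t}"
    using finite_col by (rule rev_finite_subset) blast
  ultimately obtain c where
    "c \<in> W" "Q m c x" "\<forall>d\<in>W. R m c d \<and> Q m d x \<longrightarrow> col d \<notin> {t \<in> col ` C. \<not> cofinal m x t}"
    by blast
  then show thesis using that[of c] W_C by blast
qed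

text \<open>Some colour is cofinal in the cut from both sides.  Otherwise choose \<open>c\<close> below and \<open>d\<close> above
  the cut, so close to it that below the cut only colours cofinal from below occur in the interval,
  and above it none of them does.  Then the cut is definable over \<open>W\<close>: the points of the interval
  coloured in this way have a supremum \<open>s \<in> W\<close>.  But \<open>s\<close> cannot lie below the cut, as there
  is no last point there and later points are still in the set; nor above it, as a smaller point
  \<open>v\<close> above the cut would not be an upper bound, giving a point of \<open>W\<close> above the cut with a forbidden
  colour.\<close>

lemma gap_colour:
  assumes x: "gap x"
  shows "\<exists>w\<in>W. \<forall>m. cofinal m x (col w)"
proof (rule ccontr)
  assume none: "\<not> ?thesis"
  have not_both: False if "w \<in> W" "cofinal Fut x (col w)" "cofinal Past x (col w)" for w
    using none that tense.exhaust by metis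
  have xC: "x \<in> C" using x by simp
  have past: "R Past y z \<longleftrightarrow> R Fut z y" "Q Past y z \<longleftrightarrow> Q Fut z y" if "y \<in> C" "z \<in> C" for y z
    using opp_C[OF that(2,1), of Fut] Q_opp[OF that(2,1), of Fut] by simp_all
  \<comment> \<open>\<open>c\<close> and \<open>d\<close> are close enough to the cut for all colours between to be cofinal.\<close>
  obtain c where c: "c \<in> W" "Q Fut c x"
    "\<And>w. w \<in> W \<Longrightarrow> R Fut c w \<Longrightarrow> Q Fut w x \<Longrightarrow> cofinal Fut x (col w)"
    using eventually_cofinal[OF x] by blast
  obtain d where d: "d \<in> W" "Q Past d x"
    "\<And>w. w \<in> W \<Longrightarrow> R Past d w \<Longrightarrow> Q Past w x \<Longrightarrow> cofinal Past x (col w)"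
    using eventually_cofinal[OF x] by blast
  have C: "c \<in> C" "d \<in> C" using c d by simp_all
  have xd: "R Fut x d" using gap_R[OF x d(1), of Past] d(2) past C xC by blast
  define S where "S = {t \<in> col ` C. cofinal Fut x t}"
  define Y where "Y = between col c d S"
  have S: "S \<subseteq> col ` C" by (auto simp: S_def)
  have inY: "w \<in> Y" if w: "w \<in> W" "R Fut c w" "Q Fut w x" for w
  proof -
    have wC: "w \<in> C" using w by simp
    have "R Fut w d" using trans_C[OF wC xC C(2) _ xd] gap_R[OF x w(1)] w(3) by blast
    then show ?thesis using w c(3)[OF w] wC by (auto simp: Y_def S_def between_def)
  qed
  obtain c1 where c1: "c1 \<in> W" "Q Fut c1 x" "R Fut c c1" using gap_no_last[OF x c(1,2)] by blast
  have c1Y: "c1 \<in> Y" by (rule inY[OF c1(1,3,2)])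
  then obtain s where s: "s \<in> W" "is_sup Fut Y s"
    using sup_W[OF c(1) d(1) S] unfolding Y_def by blast
  have sC: "s \<in> C" and up: "upper Fut Y s" and least: "\<And>u. u \<in> C \<Longrightarrow> upper Fut Y u \<Longrightarrow> s = u \<or> R Fut s u"
    using s by (auto simp: is_sup_def)
  show False
  proof (cases "Q Fut s x")
    case True
    then obtain c' where c': "c' \<in> W" "Q Fut c' x" "R Fut s c'" "\<not> R Fut c' s"
      using gap_no_last[OF x s(1)] by blast
    have C': "c1 \<in> C" "c' \<in> C" using c1 c' by simp_all
    have "c1 = s \<or> R Fut c1 s" using up c1Y by (simp add: upper_def)
    then have "R Fut c s" using c1(3) trans_C[OF C(1) C'(1) sC] by blast
    then have "R Fut c c'" using trans_C[OF C(1) sC C'(2)] c'(3) by blast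
    then have "c' \<in> Y" by (rule inY[OF c'(1) _ c'(2)])
    then have "c' = s \<or> R Fut c' s" using up unfolding upper_def by blast
    then show False using c' by auto
  next
    case False
    then have sx: "Q Past s x" using gap_dichotomy[OF x s(1), of Fut] past sC xC by blast
    \<comment> \<open>the earlier one of \<open>s\<close> and \<open>d\<close>\<close>
    obtain e where e: "e \<in> W" "Q Past e x" "e = s \<or> R Fut e s" "e = d \<or> R Fut e d"
      using total_C[OF sC C(2), of Fut] s(1) sx d(1,2) by blast
    have eC: "e \<in> C" using e by simp
    obtain v where v: "v \<in> W" "Q Past v x" "R Past e v" "\<not> R Past v e"
      using gap_no_last[OF x e(1,2)] by blast
    have vC: "v \<in> C" using v by simp
    have ve: "R Fut v e" "\<not> R Fut e v" using v past eC vC by blast+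
    have vs: "R Fut v s" "R Fut v d" using e ve trans_C[OF vC eC] sC C by blast+
    have nsv: "\<not> R Fut s v" using e(3) ve(2) trans_C[OF eC sC vC] by blast
    then have "s \<noteq> v" using vs by blast
    then have "\<not> upper Fut Y v" using least[OF vC] nsv by blast
    then obtain z where z: "z \<in> Y" "z \<noteq> v" "\<not> R Fut z v" unfolding upper_def by blast
    have "z \<in> between col v d S"
      using z total_C[OF vC, of z Fut] unfolding Y_def between_def by blast
    then obtain w where w: "w \<in> W" "w \<in> between col v d S" using inside[OF v(1) d(1) S] by blast
    have wC: "w \<in> C" and wr: "R Fut v w" "R Fut w d" "cofinal Fut x (col w)"
      using w by (auto simp: between_def S_def)
    have "R Fut x v" using gap_R[OF x v(1), of Past] v(2) past vC xC by blast
    then have "Q Past w x" using trans_C[OF xC vC wC _ wr(1)] R_Q past wC xC by blast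
    then have "cofinal Past x (col w)" using d(3)[OF w(1)] wr(2) past C wC by blast
    then show False using not_both w(1) wr(3) by blast
  qed
qed

section \<open>Collapsing the component onto the hull\<close>

text \<open>Points of \<open>W\<close> must be fixed, so exact restrictions take precedence over mere nearness.  A gap
  point goes to a point whose colour is cofinal on both sides of its cut; the choice depends on the
  cut alone.\<close>

definition collapse where
  "collapse x =
    (if \<exists>w\<in>W. w \<inter> B = x \<inter> B then SOME w. w \<in> W \<and> w \<inter> B = x \<inter> B
     else if \<exists>w. near w x then SOME w. near w x
     else SOME w. w \<in> W \<and> (\<forall>m. cofinal m x (col w)))"

lemma collapse_W: "w \<in> W \<Longrightarrow> collapse w = w"
proof -
  assume w: "w \<in> W"
  then have "collapse w \<in> W \<and> collapse w \<inter> B = w \<inter> B"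
    using someI_ex[of "\<lambda>v. v \<in> W \<and> v \<inter> B = w \<inter> B"] unfolding collapse_def by auto
  then show ?thesis using W_eq w by blast
qed

lemma collapse_cong: "x \<inter> B = y \<inter> B \<Longrightarrow> collapse x = collapse y"
  by (simp only: collapse_def near_def cofinal_def Q_def)

lemma collapse_near:
  assumes "x \<in> C" "\<not> gap x"
  shows "near (collapse x) x"
proof (cases "\<exists>w\<in>W. w \<inter> B = x \<inter> B")
  case True
  then obtain w where w: "w \<in> W" "w \<inter> B = x \<inter> B" by blast
  then have "collapse x = w" using collapse_W collapse_cong by metis
  then show ?thesis using w by (simp add: near_def Q_def)
next
  case False
  then show ?thesis using assms someI_ex[of "\<lambda>w. near w x"] by (auto simp: collapse_def gap_def)
qed

lemma collapse_gap_eq: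
  assumes "gap x"
  shows "collapse x = (SOME w. w \<in> W \<and> (\<forall>m. cofinal m x (col w)))"
proof -
  have no: "\<not> (\<exists>w. near w x)" using assms unfolding gap_def by blast
  moreover have "near w x" if "w \<in> W" "w \<inter> B = x \<inter> B" for w
    using that by (simp add: near_def Q_def)
  ultimately have "\<not> (\<exists>w\<in>W. w \<inter> B = x \<inter> B)" by blast
  then show ?thesis using no by (simp only: collapse_def if_False)
qed

lemma collapse_gap:
  assumes "gap x"
  shows "collapse x \<in> W" "cofinal m x (col (collapse x))"
proof -
  have "collapse x \<in> W \<and> (\<forall>m. cofinal m x (col (collapse x)))"
    unfolding collapse_gap_eq[OF assms] by (rule someI_ex) (use gap_colour[OF assms] in blast)
  then show "collapse x \<in> W" "cofinal m x (col (collapse x))" by auto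
qed

lemma collapse_in_W: "x \<in> C \<Longrightarrow> collapse x \<in> W"
  using collapse_near collapse_gap(1) unfolding near_def by blast

lemma collapse_same_cut:
  assumes x: "gap x" and y: "gap y" and eq: "\<And>m w. w \<in> W \<Longrightarrow> Q m w x \<longleftrightarrow> Q m w y"
  shows "collapse x = collapse y"
proof -
  have "cofinal m x t \<longleftrightarrow> cofinal m y t" for m t
    unfolding cofinal_def using eq by blast
  then show ?thesis by (simp only: collapse_gap_eq[OF x] collapse_gap_eq[OF y])
qed

text \<open>Seen through \<open>collapse\<close>, the small frame satisfies the clause for \<open>Dia m\<close> in which \<open>X\<close> is the truth
  set of the argument and \<open>D\<close> that of the diamond.  At a gap point \<open>x\<close> the value \<open>collapse x\<close> may lie
  anywhere in \<open>W\<close>, but points of its colour occur arbitrarily close to \<open>x\<close> on both sides.  Taking one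
  after \<open>x\<close> shows that the diamond is not claimed without a witness, and taking one just before a
  witness shows that the diamond is not missed.\<close>

lemma collapse_dia:
  assumes X: "\<And>v w. v \<in> C \<Longrightarrow> w \<in> C \<Longrightarrow> col v = col w \<Longrightarrow> v \<in> X \<longleftrightarrow> w \<in> X"
    and D: "\<And>v w. v \<in> C \<Longrightarrow> w \<in> C \<Longrightarrow> col v = col w \<Longrightarrow> v \<in> D \<longleftrightarrow> w \<in> D"
    and DX: "\<And>v. v \<in> C \<Longrightarrow> v \<in> D \<longleftrightarrow> (\<exists>y\<in>C. R m v y \<and> y \<in> X)"
    and x: "x \<in> C"
  shows "collapse x \<in> D \<longleftrightarrow> (\<exists>y\<in>C. Q m x y \<and> collapse y \<in> X)"
proof
  assume fD: "collapse x \<in> D"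
  obtain v where v: "v \<in> W" "v \<in> D" "\<And>y. y \<in> C \<Longrightarrow> Q m v y \<Longrightarrow> Q m x y"
  proof (cases "gap x")
    case False
    then have n: "near (collapse x) x" by (rule collapse_near[OF x])
    show thesis by (rule that[of "collapse x"]) (use n fD x near_Q[OF n x] in \<open>auto simp: near_def\<close>)
  next
    case True
    obtain c where c: "c \<in> W" "Q (opp m) c x" using gap_below[OF True] by blast
    then obtain v where v: "v \<in> W" "Q (opp m) v x" "col v = col (collapse x)"
      using collapse_gap(2)[OF True, of "opp m"] unfolding cofinal_def by blast
    have vC: "v \<in> C" "collapse x \<in> C" using v collapse_in_W[OF x] by auto
    have "Q m x v" using v(2) Q_opp[OF x vC(1)] by simp
    moreover have "v \<in> D" using D[OF vC v(3)] fD by simp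
    ultimately show thesis using that[of v] v(1) Q_trans[OF x vC(1)] by blast
  qed
  then obtain y where y: "y \<in> C" "R m v y" "y \<in> X" using DX[of v] by auto
  then obtain w where w: "w \<in> W" "R m v w" "col w = col y" using beyond[OF v(1)] by blast
  then have "w \<in> C" "w \<in> X" using X[of w y] y by auto
  then show "\<exists>y\<in>C. Q m x y \<and> collapse y \<in> X" using v(3) R_Q w collapse_W by metis
next
  assume "\<exists>y\<in>C. Q m x y \<and> collapse y \<in> X"
  then obtain y where y: "y \<in> C" "Q m x y" "collapse y \<in> X" by blast
  let ?v = "collapse x" and ?w = "collapse y"
  have W: "?v \<in> W" "?w \<in> W" using collapse_in_W x y by auto
  then have C: "?v \<in> C" "?w \<in> C" by auto
  \<comment> \<open>Either a point of \<open>X\<close> in the hull above \<open>x\<close> is found, or \<open>x\<close> and \<open>y\<close> are in the same gap.\<close>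
  have reach: "?v \<in> D" if w: "w \<in> W" "w \<in> X" "Q m x w" for w
  proof (cases "gap x")
    case False
    then have n: "near ?v x" by (rule collapse_near[OF x])
    then have "Q m ?v w" using near_Q(1)[OF n x] w by simp
    then show ?thesis using W_Q[OF W(1) w(1)] DX[OF C(1)] w by auto
  next
    case True
    have wC: "w \<in> C" using w by simp
    have "Q (opp m) w x" using Q_opp[OF x wC] w(3) by simp
    then obtain c where c: "c \<in> W" "R (opp m) w c" "col c = col ?v"
      using collapse_gap(2)[OF True, of "opp m"] w(1) unfolding cofinal_def by blast
    have cC: "c \<in> C" using c by simp
    have "R m c w" using opp_C[OF cC wC] c(2) by simp
    then have "c \<in> D" using DX[OF cC] wC w(2) by blast
    then show ?thesis using D[OF cC C(1) c(3)] by simp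
  qed
  have above: "\<exists>w\<in>W. w \<in> X \<and> R m u w" if u: "u \<in> W" "Q m u y" for u
  proof (cases "gap y")
    case False
    then have n: "near ?w y" by (rule collapse_near[OF y(1)])
    then have "Q m u ?w" using near_Q(2)[OF n y(1)] u by simp
    then show ?thesis using W_Q[OF u(1) W(2)] W(2) y(3) by blast
  next
    case True
    then obtain w where w: "w \<in> W" "R m u w" "col w = col ?w"
      using collapse_gap(2)[OF True, of m] u unfolding cofinal_def by blast
    then have "w \<in> X" using X[OF _ C(2) w(3)] y(3) by simp
    then show ?thesis using w by blast
  qed
  show "?v \<in> D"
  proof (cases "gap x")
    case False
    then have n: "near ?v x" by (rule collapse_near[OF x])
    then have "Q m ?v y" using near_Q(1)[OF n x y(1)] y(2) by simp
    then obtain w where "w \<in> W" "w \<in> X" "R m ?v w" using above W(1) by blast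
    then show ?thesis using DX[OF C(1)] by auto
  next
    case gx: True
    show ?thesis
    proof (cases "gap y")
      case False
      then have n: "near ?w y" by (rule collapse_near[OF y(1)])
      then have "Q m x ?w" using near_Q(2)[OF n y(1) x] y(2) by simp
      then show ?thesis using reach W(2) y(3) by blast
    next
      case gy: True
      show ?thesis
      proof (cases "\<exists>u\<in>W. Q m x u \<and> Q m u y")
        case True
        then obtain u where u: "u \<in> W" "Q m x u" "Q m u y" by blast
        then obtain w where w: "w \<in> W" "w \<in> X" "R m u w" using above by blast
        have uw: "u \<in> C" "w \<in> C" using u w by simp_all
        have "Q m x w" using Q_trans[OF x uw u(2)] w(3) R_Q by blast
        then show ?thesis using reach w by blast
      next
        case False
        \<comment> \<open>No point of \<open>W\<close> lies between \<open>x\<close> and \<open>y\<close>, so they define the same cut.\<close>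
        have eq: "Q m w x \<longleftrightarrow> Q m w y" if w: "w \<in> W" for w
          using False w gap_dichotomy[OF gx w, of m] Q_trans[of w x y m] x y by auto
        have eq': "Q (opp m) w x \<longleftrightarrow> Q (opp m) w y" if w: "w \<in> W" for w
          using eq[OF w] w gap_dichotomy[OF gx w, of m] gap_dichotomy[OF gy w, of m]
            Q_opp[of x w m] Q_opp[of y w m] x y by simp
        have "Q n w x \<longleftrightarrow> Q n w y" if "w \<in> W" for n w
        proof (cases "n = m")
          case False
          then have "n = opp m" by (cases n; cases m) auto
          then show ?thesis using eq' that by simp
        qed (use eq that in simp)
        then have same: "?v = ?w" by (rule collapse_same_cut[OF gx gy])
        obtain c where c: "c \<in> W" "Q (opp m) c x" using gap_below[OF gx] by blast
        then obtain c1 where c1: "c1 \<in> W" "Q (opp m) c1 x" "col c1 = col ?v"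
          using collapse_gap(2)[OF gx, of "opp m"] unfolding cofinal_def by blast
        have c1C: "c1 \<in> C" using c1 by simp
        have "Q m x c1" using Q_opp[OF x c1C] c1(2) by simp
        moreover have "c1 \<in> X" using X[OF c1C C(1) c1(3)] same y(3) by simp
        ultimately show ?thesis using reach c1(1) by blast
      qed
    qed
  qed
qed

end

section \<open>Transfer of validity\<close>

primrec subfms :: "'m fm \<Rightarrow> 'm fm set" where
  "subfms (Atom n) = {Atom n}"
| "subfms Top = {Top}"
| "subfms (Neg \<phi>) = insert (Neg \<phi>) (subfms \<phi>)"
| "subfms (Disj \<phi> \<psi>) = insert (Disj \<phi> \<psi>) (subfms \<phi> \<union> subfms \<psi>)"
| "subfms (Dia m \<phi>) = insert (Dia m \<phi>) (subfms \<phi>)"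

lemma finite_subfms: "finite (subfms \<phi>)"
  by (induction \<phi>) auto

lemma subfms_refl: "\<phi> \<in> subfms \<phi>"
  by (cases \<phi>) auto

context hull
begin

text \<open>The valuation on the small frame is the pullback of \<open>V\<close> along \<open>collapse\<close>; since \<open>collapse\<close> fixes
  \<open>\<mu>\<^sub>0\<close>, the truth value there is the original one.\<close>

lemma collapse_truth:
  assumes V: "range V \<subseteq> carr (canon_ext A)"
    and inv: "\<And>\<theta> v w. \<theta> \<in> \<Phi> \<Longrightarrow> v \<in> C \<Longrightarrow> w \<in> C \<Longrightarrow> col v = col w \<Longrightarrow>
      v \<in> eval (canon_ext A) V \<theta> \<longleftrightarrow> w \<in> eval (canon_ext A) V \<theta>"
    and sub: "subfms \<psi> \<subseteq> \<Phi>" and x: "x \<in> C"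
  shows "x \<inter> B \<in> eval (canon_ext A') (\<lambda>n. {y \<inter> B | y. y \<in> C \<and> collapse y \<in> V n}) \<psi>
    \<longleftrightarrow> collapse x \<in> eval (canon_ext A) V \<psi>"
  using sub x
proof (induction \<psi> arbitrary: x)
  case (Atom n)
  have "(\<exists>y. x \<inter> B = y \<inter> B \<and> y \<in> C \<and> collapse y \<in> V n) \<longleftrightarrow> collapse x \<in> V n"
    using Atom.prems collapse_cong[of x] by metis
  then show ?case by simp
next
  case Top
  then show ?case using restrict_ultrafilter[of x] collapse_in_W[of x] by (simp add: canon_ext_def)
next
  case (Neg \<psi>)
  then show ?case
    using restrict_ultrafilter[of x] collapse_in_W[of x] by (simp add: canon_ext_def)
next
  case (Disj \<psi> \<chi>)
  then show ?case by (simp add: canon_ext_def)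
next
  case (Dia m \<psi>)
  let ?E = "canon_ext A" and ?E' = "canon_ext A'"
  let ?V = "\<lambda>n. {y \<inter> B | y. y \<in> C \<and> collapse y \<in> V n}"
  have "range ?V \<subseteq> carr ?E'" using restrict_ultrafilter by (auto simp: canon_ext_def)
  then have E': "eval ?E' ?V \<psi> \<subseteq> ultrafilters A'"
    using eval_in_carr[OF is_bao_canon_ext, of ?V A' \<psi>] by (simp add: canon_ext_def)
  have E: "eval ?E V \<psi> \<subseteq> U"
    using eval_in_carr[OF is_bao_canon_ext V, of \<psi>] by (simp add: canon_ext_def)
  have \<Phi>: "\<psi> \<in> \<Phi>" "Dia m \<psi> \<in> \<Phi>" "subfms \<psi> \<subseteq> \<Phi>" using Dia.prems(1) subfms_refl by auto
  have "x \<inter> B \<in> eval ?E' ?V (Dia m \<psi>) \<longleftrightarrow> (\<exists>\<nu>\<in>eval ?E' ?V \<psi>. R m (x \<inter> B) \<nu>)"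
    using restrict_ultrafilter[of x] Dia.prems(2) by (simp add: canon_ext_def)
  also have "\<dots> \<longleftrightarrow> (\<exists>y\<in>C. Q m x y \<and> y \<inter> B \<in> eval ?E' ?V \<psi>)"
  proof
    assume "\<exists>\<nu>\<in>eval ?E' ?V \<psi>. R m (x \<inter> B) \<nu>"
    then obtain \<nu> where \<nu>: "\<nu> \<in> eval ?E' ?V \<psi>" "R m (x \<inter> B) \<nu>" by blast
    then obtain y where "y \<in> C" "R m x y" "y \<inter> B = \<nu>"
      using restrict_bounded[OF Dia.prems(2)] E' by blast
    then show "\<exists>y\<in>C. Q m x y \<and> y \<inter> B \<in> eval ?E' ?V \<psi>" using R_Q \<nu>(1) by blast
  qed (auto simp: Q_def)
  also have "\<dots> \<longleftrightarrow> (\<exists>y\<in>C. Q m x y \<and> collapse y \<in> eval ?E V \<psi>)"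
    using Dia.IH[OF \<Phi>(3)] by blast
  also have "\<dots> \<longleftrightarrow> collapse x \<in> eval ?E V (Dia m \<psi>)"
  proof (rule collapse_dia[symmetric])
    show "v \<in> eval ?E V (Dia m \<psi>) \<longleftrightarrow> (\<exists>y\<in>C. R m v y \<and> y \<in> eval ?E V \<psi>)" if v: "v \<in> C" for v
      using v E C_step[OF v] by (auto simp: canon_ext_def)
  qed (use inv \<Phi> Dia.prems(2) in blast)+
  finally show ?case .
qed

lemma generate_A': "generate A' B = B"
proof
  have "x \<in> B" if "x \<in> generate A' B" for x
    using that by induction (simp_all add: zero_B one_B join_B meet_B cpl_B dia_B)
  then show "generate A' B \<subseteq> B" by blast
qed (auto intro: generate.base)

end

theorem mainTheorem4:
  fixes L :: "tense fm set"
  assumes "linear_temporal_logic L"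
    and "kappa_canonical TYPE(nat) natLeq L"
  shows "totally_canonical TYPE('a) L"
  unfolding totally_canonical_def
proof (intro allI impI)
  fix A :: "(tense, 'a) bao"
  assume A: "A \<in> variety L"
  have can: "kappa_canonical TYPE('a) natLeq L" by (rule omega_canonical_transfer[OF assms(2)])
  let ?E = "canon_ext A"
  have "eval ?E V \<phi> = one_of ?E" if \<phi>: "\<phi> \<in> L" and V: "range V \<subseteq> carr ?E" for \<phi> V
  proof -
    have "\<mu> \<in> eval ?E V \<phi>" if \<mu>: "\<mu> \<in> ultrafilters A" for \<mu>
    proof -
      interpret component L A \<mu> using assms(1) A \<mu> by unfold_locales
      define col where "col x = {\<psi> \<in> subfms \<phi>. x \<in> eval ?E V \<psi>}" for x
      have "finite (col ` C)"
        by (rule finite_subset[of _ "Pow (subfms \<phi>)"]) (auto simp: col_def finite_subfms)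
      then obtain W B where "hull L A \<mu> col W B" by (rule hull_exists)
      then interpret hull L A \<mu> col W B .
      obtain g :: "'a \<Rightarrow> nat" where "inj_on g B" using countable_B by (auto simp: countable_def)
      then have "|B| \<le>o |UNIV :: nat set|" using card_of_ordLeq[of B] by blast
      then have "|B| \<le>o natLeq" using card_of_nat by (rule ordLeq_ordIso_trans)
      then have ex: "\<exists>X\<subseteq>carr A'. |X| \<le>o natLeq \<and> generate A' X = carr A'"
        using generate_A' by (intro exI[of _ B]) simp
      have "canon_ext A' \<in> variety L"
        using can A'_variety ex unfolding kappa_canonical_def by blast
      moreover have "range (\<lambda>n. {y \<inter> B | y. y \<in> C \<and> collapse y \<in> V n}) \<subseteq> carr (canon_ext A')"
        using restrict_ultrafilter by (auto simp: canon_ext_def)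
      ultimately have "eval (canon_ext A') (\<lambda>n. {y \<inter> B | y. y \<in> C \<and> collapse y \<in> V n}) \<phi>
          = ultrafilters A'"
        using \<phi> unfolding variety_def by (auto simp: canon_ext_def)
      moreover have "v \<in> eval ?E V \<theta> \<longleftrightarrow> w \<in> eval ?E V \<theta>"
        if "\<theta> \<in> subfms \<phi>" "col v = col w" for \<theta> v w
        using that unfolding col_def by blast
      ultimately have "collapse \<mu> \<in> eval ?E V \<phi>"
        using collapse_truth[OF V _ subset_refl root_C] restrict_ultrafilter[OF \<mu>] by blast
      then show ?thesis using collapse_W[OF root_W] by simp
    qed
    moreover have "eval ?E V \<phi> \<subseteq> ultrafilters A"
      using eval_in_carr[OF is_bao_canon_ext V, of \<phi>] by (simp add: canon_ext_def)
    ultimately show ?thesis by (auto simp: canon_ext_def)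
  qed
  then show "?E \<in> variety L" by (simp add: variety_def is_bao_canon_ext)
qed

end
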